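(* Let $G(n,p)$ be an Erdős–Rényi random graph with $p=\lambda/n$, where $\lambda=\lambda_n>1$ remains bounded away from $1$ as $n\to\infty$. Fix an integer $m\ge1$ and assume $\lambda=o(n^{1/(2m+2)})$. Let $C_{\mathrm{giant}}$ be the largest connected component of $G(n,p)$ and $\operatorname{Core}_2(C_{\mathrm{giant}})$ its $2$-core. Then $$\lim_{n\to\infty}\mathbb{P}\bigl(\operatorname{Core}_2(C_{\mathrm{giant}})\text{ admits a switching of size}\le m\text{ that yields a graph not isomorphic to }\operatorname{Core}_2(C_{\mathrm{giant}})\bigr)=0,$$ i.e. with probability tending to one, every graph obtainable from $\operatorname{Core}_2(C_{\mathrm{giant}})$ by a switching of size at most $m$ is isomorphic to it.
   Context: Graphs are finite and simple. The $2$-core of a graph is the subgraph that remains after iteratively removing all vertices of degree less than $2$. Switching of size $\le m$: given a graph $G$ on $N\ge m$ vertices, a graph $H$ is obtained from $G$ by a switching of size $\le m$ if there exist orderings of the vertices of $G$ and $H$ such that their adjacency matrices satisfy $A_H=(Q\oplus I_{N-m})^{T}A_G(Q\oplus I_{N-m})$ for some $m\times m$ real orthogonal matrix $Q$ that is not a permutation matrix, where $I_{N-m}$ is the identity matrix and $\oplus$ denotes block-diagonal sum. In $G(n,p)$ each possible edge is present independently with probability $p$. *)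

theory Defs
  imports "HOL-Probability.Probability" "HOL-Library.Landau_Symbols" "Jordan_Normal_Form.Matrix"
begin

definition simple_graph :: "nat set \<Rightarrow> nat set set \<Rightarrow> bool" where
  "simple_graph V E \<longleftrightarrow> finite V \<and> E \<subseteq> {{u, v} | u v. u \<in> V \<and> v \<in> V \<and> u \<noteq> v}"

definition all_pairs :: "nat \<Rightarrow> nat set set" where
  "all_pairs n = {{u, v} | u v. u < n \<and> v < n \<and> u \<noteq> v}"

definition gnp :: "nat \<Rightarrow> real \<Rightarrow> nat set set pmf" where
  "gnp n p = map_pmf (\<lambda>f. {e \<in> all_pairs n. f e})
                     (Pi_pmf (all_pairs n) False (\<lambda>_. bernoulli_pmf p))"

definition component :: "nat set \<Rightarrow> nat set set \<Rightarrow> nat \<Rightarrow> nat set" where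
  "component V E v = {u \<in> V. (\<lambda>x y. x \<in> V \<and> y \<in> V \<and> {x, y} \<in> E)\<^sup>*\<^sup>* v u}"

definition is_component :: "nat set \<Rightarrow> nat set set \<Rightarrow> nat set \<Rightarrow> bool" where
  "is_component V E C \<longleftrightarrow> (\<exists>v \<in> V. C = component V E v)"

definition largest_component :: "nat set \<Rightarrow> nat set set \<Rightarrow> nat set \<Rightarrow> bool" where
  "largest_component V E C \<longleftrightarrow>
     is_component V E C \<and> (\<forall>D. is_component V E D \<longrightarrow> card D \<le> card C)"

definition induced_edges :: "nat set set \<Rightarrow> nat set \<Rightarrow> nat set set" where
  "induced_edges E S = {e \<in> E. e \<subseteq> S}"

definition peel :: "nat set set \<Rightarrow> nat set \<Rightarrow> nat set" where
  "peel E S = {v \<in> S. card {u \<in> S. u \<noteq> v \<and> {u, v} \<in> E} \<ge> 2}"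

text \<open>The vertex set of the 2-core: iterate peeling; after card V steps it is stationary.\<close>

definition core2 :: "nat set \<Rightarrow> nat set set \<Rightarrow> nat set" where
  "core2 V E = (peel E ^^ card V) V"

definition graph_iso :: "nat set \<Rightarrow> nat set set \<Rightarrow> nat set \<Rightarrow> nat set set \<Rightarrow> bool" where
  "graph_iso V E W F \<longleftrightarrow> (\<exists>f. bij_betw f V W \<and>
      (\<forall>u \<in> V. \<forall>v \<in> V. {u, v} \<in> E \<longleftrightarrow> {f u, f v} \<in> F))"

definition adj_mat :: "nat \<Rightarrow> (nat \<Rightarrow> nat) \<Rightarrow> nat set set \<Rightarrow> real mat" where
  "adj_mat N \<sigma> E = mat N N (\<lambda>(i, j). if i \<noteq> j \<and> {\<sigma> i, \<sigma> j} \<in> E then 1 else 0)"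

definition orthogonal_mat :: "nat \<Rightarrow> real mat \<Rightarrow> bool" where
  "orthogonal_mat m Q \<longleftrightarrow> Q \<in> carrier_mat m m \<and> transpose_mat Q * Q = 1\<^sub>m m"

definition permutation_mat :: "nat \<Rightarrow> real mat \<Rightarrow> bool" where
  "permutation_mat m Q \<longleftrightarrow> (\<exists>\<pi>. bij_betw \<pi> {0..<m} {0..<m} \<and>
      Q = mat m m (\<lambda>(i, j). if j = \<pi> i then 1 else 0))"

definition switching_le :: "nat \<Rightarrow> nat set \<Rightarrow> nat set set \<Rightarrow> nat set \<Rightarrow> nat set set \<Rightarrow> bool" where
  "switching_le m V E W F \<longleftrightarrow>
     (let N = card V in m \<le> N \<and>
      (\<exists>\<sigma> \<tau> Q. bij_betw \<sigma> {0..<N} V \<and> bij_betw \<tau> {0..<N} W \<and>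
         orthogonal_mat m Q \<and> \<not> permutation_mat m Q \<and>
         (let R = four_block_mat Q (0\<^sub>m m (N - m)) (0\<^sub>m (N - m) m) (1\<^sub>m (N - m)) in
            adj_mat N \<tau> F = transpose_mat R * adj_mat N \<sigma> E * R)))"

definition admits_noniso_switching :: "nat \<Rightarrow> nat set \<Rightarrow> nat set set \<Rightarrow> bool" where
  "admits_noniso_switching m V E \<longleftrightarrow>
     (\<exists>W F. simple_graph W F \<and> switching_le m V E W F \<and> \<not> graph_iso V E W F)"

definition bad_event :: "nat \<Rightarrow> nat \<Rightarrow> nat set set \<Rightarrow> bool" where
  "bad_event m n E \<longleftrightarrow> (\<exists>C. largest_component {0..<n} E C \<and>
      (let K = core2 C (induced_edges E C) in
        admits_noniso_switching m K (induced_edges E K)))"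

end

theory Submission
  imports "Jordan_Normal_Form.Determinant" Defs
begin

text \<open>
  If the switched graph is not isomorphic to the 2-core, then some set of at most \<open>2m + 1\<close> vertices
  spans more edges than it has vertices; the expected number of such sets is
  \<open>O(\<lambda>\<^sup>2\<^sup>m\<^sup>+\<^sup>2 / n)\<close>, which tends to 0.

  For the deterministic part, vertices whose row of the orthogonal matrix is a unit vector are only
  renamed. Let \<open>S\<close> be the set of the others and \<open>T\<close> the set of outside neighbours of \<open>S\<close>. No
  vertex of \<open>T\<close> has exactly one neighbour in \<open>S\<close>, because orthogonality would turn that neighbour's
  row into a unit vector. As all degrees are at least 2, sparsity forces \<open>card T \<le> card S\<close> and then
  that \<open>S \<union> T\<close> induces a disjoint union of cycles. The switched graph on the corresponding vertices
  has as many edges and its largest eigenvalue is 2, so it is 2-regular as well. The two 2-regular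
  graphs are cospectral and have the same numbers of walks between vertices of \<open>T\<close>, which yields an
  isomorphism that respects \<open>T\<close> and extends to all vertices.
\<close>

section \<open>2-regular graphs\<close>

text \<open>The obstacle is that an isomorphism of the switched part must agree with the renaming on
  \<open>T\<close>, because the rest of the graph is attached through these vertices. Cospectrality
  carries no information about positions, so matrix entries between vertices of \<open>T\<close>
  have to be compared as well. The same orthogonal matrix intertwines every polynomial in the two
  adjacency matrices. The Chebyshev family is chosen because on a cycle its entries are indicators
  of cyclic distance and its diagonal tests divisibility by the cycle length, so lengths and
  distances can be read off directly.

  The number 2m + 1 arises from \<open>T\<close>: if \<open>T\<close> were larger than
  \<open>S\<close>, then card S + 1 of its vertices together with \<open>S\<close> would be at most
  2m + 1 vertices spanning at least 2 card S + 2 edges. Sets of k vertices with k + 1 edges have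
  expected number of order n^k (\<lambda>/n)^(k+1) = \<lambda>^(k+1)/n. The worst case k = 2m + 1 is
  the origin of the exponent 2m + 2.\<close>

definition two_regular :: "('a \<Rightarrow> 'a set) \<Rightarrow> 'a set \<Rightarrow> bool" where
  "two_regular N B \<longleftrightarrow> finite B \<and>
     (\<forall>x\<in>B. N x \<subseteq> B \<and> card (N x) = 2 \<and> x \<notin> N x) \<and>
     (\<forall>x\<in>B. \<forall>y\<in>B. y \<in> N x \<longleftrightarrow> x \<in> N y)"

text \<open>The entries of \<open>2 T\<^sub>j(A / 2)\<close> for the Chebyshev polynomial \<open>T\<^sub>j\<close> and the adjacency matrix \<open>A\<close>.
  On a cycle with rotation \<open>P\<close> this matrix is \<open>P\<^sup>j + P\<^sup>-\<^sup>j\<close>.\<close>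

fun cheb :: "('a \<Rightarrow> 'a set) \<Rightarrow> nat \<Rightarrow> 'a \<Rightarrow> 'a \<Rightarrow> real" where
  "cheb N 0 x y = 2 * of_bool (x = y)"
| "cheb N (Suc 0) x y = of_bool (y \<in> N x)"
| "cheb N (Suc (Suc j)) x y = (\<Sum>z\<in>N x. cheb N (Suc j) z y) - cheb N j x y"

section \<open>Cycles as periodic walks indexed by the integers\<close>

text \<open>Indexing by all integers turns rotations and reflections of a cycle into
  \<open>i + d\<close> and \<open>- i\<close>. The inequality forbids turning back.\<close>

definition traversal :: "('a \<Rightarrow> 'a set) \<Rightarrow> 'a set \<Rightarrow> (int \<Rightarrow> 'a) \<Rightarrow> bool" where
  "traversal N B s \<longleftrightarrow> (\<forall>i. s i \<in> B \<and> N (s i) = {s (i - 1), s (i + 1)} \<and> s (i - 1) \<noteq> s (i + 1))"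

lemma other_neighbour:
  assumes "two_regular N B" "u \<in> B" "v \<in> N u"
  obtains w where "w \<in> N v" "N v = {u, w}" "u \<noteq> w" "v \<in> B"
proof -
  have v: "v \<in> B" and uv: "u \<in> N v"
    using assms unfolding two_regular_def by blast+
  then have "card (N v) = 2" using assms(1) unfolding two_regular_def by blast
  then obtain p q where pq: "N v = {p, q}" "p \<noteq> q" by (meson card_2_iff)
  with uv consider "u = p" | "u = q" by blast
  then show thesis
    by cases (use pq v that in auto)
qed

text \<open>The next vertex depends on the last two, so the dependent choice runs over directed
  edges: the state is the pair of current and next vertex.\<close>

lemma forward_walk:
  assumes "two_regular N B" "x \<in> B" "y \<in> N x"
  shows "\<exists>p. p 0 = x \<and> p (Suc 0) = y \<and>
    (\<forall>n. p n \<in> B \<and> N (p (Suc n)) = {p n, p (Suc (Suc n))} \<and> p n \<noteq> p (Suc (Suc n)))"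
proof -
  define P where "P = (\<lambda>n::nat. \<lambda>d. fst d \<in> B \<and> snd d \<in> N (fst d) \<and> (n = 0 \<longrightarrow> d = (x, y)))"
  define Q where "Q = (\<lambda>(n::nat) d d'. fst d' = snd d \<and> N (snd d) = {fst d, snd d'} \<and> fst d \<noteq> snd d')"
  have 1: "\<exists>d. P 0 d" using assms unfolding P_def by auto
  have 2: "\<exists>d'. P (Suc n) d' \<and> Q n d d'" if "P n d" for n d
  proof -
    have "fst d \<in> B" "snd d \<in> N (fst d)" using that by (simp_all add: P_def)
    then obtain w where "w \<in> N (snd d)" "N (snd d) = {fst d, w}" "fst d \<noteq> w" "snd d \<in> B"
      by (rule other_neighbour[OF assms(1)])
    then show ?thesis unfolding P_def Q_def by (intro exI[of _ "(snd d, w)"]) auto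
  qed
  obtain f where f: "\<And>n. P n (f n)" "\<And>n. Q n (f n) (f (Suc n))"
    using dependent_nat_choice[of P Q, OF 1 2] by blast
  have fs: "fst (f (Suc n)) = snd (f n)" for n using f(2) unfolding Q_def by auto
  show ?thesis
    by (rule exI[of _ "\<lambda>n. fst (f n)"]) (use f fs in \<open>auto simp: P_def Q_def\<close>)
qed

lemma traversal_exists:
  assumes "two_regular N B" "x \<in> B"
  obtains s where "traversal N B s" "s 0 = x"
proof -
  have "card (N x) = 2" using assms unfolding two_regular_def by blast
  then obtain y z where yz: "N x = {y, z}" "y \<noteq> z" by (meson card_2_iff)
  obtain p where p: "p 0 = x" "p (Suc 0) = y"
    "\<And>n. p n \<in> B \<and> N (p (Suc n)) = {p n, p (Suc (Suc n))} \<and> p n \<noteq> p (Suc (Suc n))"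
    using forward_walk[OF assms, of y] yz by auto
  obtain q where q: "q 0 = x" "q (Suc 0) = z"
    "\<And>n. q n \<in> B \<and> N (q (Suc n)) = {q n, q (Suc (Suc n))} \<and> q n \<noteq> q (Suc (Suc n))"
    using forward_walk[OF assms, of z] yz by auto
  \<comment> \<open>The two halves leave \<open>x\<close> through its two different neighbours, so
    the walk does not turn back at index 0 either.\<close>
  define s where "s = (\<lambda>i::int. if i \<ge> 0 then p (nat i) else q (nat (- i)))"
  have "s i \<in> B \<and> N (s i) = {s (i - 1), s (i + 1)} \<and> s (i - 1) \<noteq> s (i + 1)" for i
  proof -
    consider "i = 0" | n where "i = int (Suc n)" | n where "i = - int (Suc n)"
      by (cases i rule: int_cases2) (metis not0_implies_Suc of_nat_0 neg_0_equal_iff_equal)+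
    then show ?thesis
    proof cases
      case 1
      have "nat (0 + 1) = Suc 0" by simp
      then show ?thesis using 1 p(1,2) q(1,2) yz assms(2) by (auto simp: s_def)
    next
      case 2
      have "s (i - 1) = p n" "s i = p (Suc n)" "s (i + 1) = p (Suc (Suc n))"
        using 2 by (simp_all add: s_def nat_add_distrib)
      then show ?thesis using p(3) by simp
    next
      case 3
      have "s (i + 1) = q n" 
        using 3 p(1) q(1) by (cases n) (auto simp: s_def nat_add_distrib)
      moreover have "s i = q (Suc n)" "s (i - 1) = q (Suc (Suc n))"
        using 3 by (auto simp: s_def nat_add_distrib intro!: arg_cong[of _ _ q])
      ultimately show ?thesis using q(3)[of n] q(3)[of "Suc n"] by auto
    qed
  qed
  then have "traversal N B s" by (simp add: traversal_def)
  moreover have "s 0 = x" using p(1) by (simp add: s_def)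
  ultimately show thesis using that by blast
qed

lemma traversal_uminus:
  assumes "traversal N B s" shows "traversal N B (\<lambda>i. s (- i))"
proof -
  have "s (- i) \<in> B \<and> N (s (- i)) = {s (- (i - 1)), s (- (i + 1))} \<and> s (- (i - 1)) \<noteq> s (- (i + 1))" for i
  proof -
    have "- (i - 1) = - i + 1" "- (i + 1) = - i - 1" by simp_all
    then show ?thesis
      using assms[unfolded traversal_def, rule_format, of "- i"]
      by (simp add: insert_commute) (metis)
  qed
  then show ?thesis by (simp add: traversal_def)
qed

text \<open>A vertex has exactly two neighbours, so two consecutive vertices determine the following
  one.\<close>

lemma traversal_shift_nat:
  assumes "traversal N B s" "s i = s k" "s (i + 1) = s (k + 1)"
  shows "s (i + int n) = s (k + int n) \<and> s (i + int n + 1) = s (k + int n + 1)"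
proof (induction n)
  case (Suc n)
  have *: "N (s j) = {s (j - 1), s (j + 1)} \<and> s (j - 1) \<noteq> s (j + 1)" for j
    using assms(1) by (simp add: traversal_def)
  have "s (i + int n + 1 + 1) = s (k + int n + 1 + 1)"
    using *[of "i + int n + 1"] *[of "k + int n + 1"] Suc.IH by (auto simp: doubleton_eq_iff)
  then show ?case using Suc.IH by (simp add: algebra_simps)
qed (use assms in auto)

lemma traversal_reflect_nat:
  assumes "traversal N B s" "s i = s k" "s (i + 1) = s (k - 1)"
  shows "s (i + int n) = s (k - int n) \<and> s (i + int n + 1) = s (k - int n - 1)"
proof (induction n)
  case (Suc n)
  have *: "N (s j) = {s (j - 1), s (j + 1)} \<and> s (j - 1) \<noteq> s (j + 1)" for j
    using assms(1) by (simp add: traversal_def)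
  have "s (i + int n + 1 + 1) = s (k - int n - 1 - 1)"
    using *[of "i + int n + 1"] *[of "k - int n - 1"] Suc.IH by (auto simp: doubleton_eq_iff)
  then show ?case using Suc.IH by (simp add: algebra_simps)
qed (use assms in auto)

text \<open>Otherwise the indices running up from \<open>i\<close> and down from \<open>k\<close>
  carry equal vertices until they meet. An even gap then gives a vertex whose two neighbours
  coincide, an odd gap a vertex adjacent to itself.\<close>

lemma traversal_no_reflection:
  assumes "two_regular N B" "traversal N B s" "s i = s k" "i \<le> k"
  shows "s (i + 1) \<noteq> s (k - 1)"
proof
  assume a: "s (i + 1) = s (k - 1)"
  have *: "N (s j) = {s (j - 1), s (j + 1)}" "s (j - 1) \<noteq> s (j + 1)" "s j \<in> B" for j
    using assms(2) by (simp_all add: traversal_def)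
  define n where "n = nat ((k - i) div 2)"
  have n: "int n = (k - i) div 2" using assms(4) by (simp add: n_def)
  note r = traversal_reflect_nat[OF assms(2,3) a, of n]
  consider "k - i = 2 * int n" | "k - i = 2 * int n + 1" using n by linarith
  then show False
  proof cases
    case 1
    then have e: "k - int n - 1 = i + int n - 1" by simp
    show ?thesis using r *(2)[of "i + int n"] unfolding e by simp
  next
    case 2
    then have e: "k - int n = i + int n + 1" by simp
    have "s (i + int n) = s (i + int n + 1)" using r unfolding e by (rule conjunct1)
    moreover have "s (i + int n + 1) \<in> N (s (i + int n))" using *(1) by simp
    ultimately have "s (i + int n) \<in> N (s (i + int n))" by metis
    then show ?thesis using assms(1) *(3) unfolding two_regular_def by blast
  qed
qed

text \<open>Equal vertices have the same pair of neighbours, so the traversal continues from both in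
  the same or in opposite directions, and the opposite case is the excluded reflection. Hence a
  coincidence propagates both ways.\<close>

lemma traversal_shift:
  assumes tr: "two_regular N B" "traversal N B s" and eq: "s i = s k"
  shows "s (i + d) = s (k + d)"
proof -
  have *: "N (s j) = {s (j - 1), s (j + 1)}" "s (j - 1) \<noteq> s (j + 1)" for j
    using tr(2) by (simp_all add: traversal_def)
  have "s (i + 1) \<noteq> s (k - 1) \<or> s (k + 1) \<noteq> s (i - 1)"
    using traversal_no_reflection[OF tr, of i k] traversal_no_reflection[OF tr, of k i] eq
    by (cases "i \<le> k") auto
  moreover have "{s (i - 1), s (i + 1)} = {s (k - 1), s (k + 1)}" using *(1) eq by metis
  ultimately have up: "s (i + 1) = s (k + 1)" and down: "s (i - 1) = s (k - 1)"
    using *(2)[of i] by (auto simp: doubleton_eq_iff)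
  show ?thesis
  proof (cases d rule: int_cases2)
    case (nonneg n)
    then show ?thesis using traversal_shift_nat[OF tr(2) eq up] by simp
  next
    case (nonpos n)
    have "s (- (- i + int n)) = s (- (- k + int n))"
      using traversal_shift_nat[OF traversal_uminus[OF tr(2)], of "- i" "- k" n] eq down by simp
    then show ?thesis using nonpos by simp
  qed
qed

text \<open>The equivalence makes \<open>L\<close> the exact period, that is, the length of the
  cycle. The value 0 would mean an injective walk, so positivity is carried separately.\<close>

definition has_period :: "nat \<Rightarrow> (int \<Rightarrow> 'a) \<Rightarrow> bool" where
  "has_period L s \<longleftrightarrow> (\<forall>i k. s i = s k \<longleftrightarrow> int L dvd i - k)"

lemma has_periodD: "has_period L s \<Longrightarrow> s i = s k \<longleftrightarrow> int L dvd i - k"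
  by (simp add: has_period_def)

lemma traversal_period:
  assumes tr: "two_regular N B" "traversal N B s"
  obtains L :: nat where "L > 0" "has_period L s"
proof -
  have "range s \<subseteq> B" using tr(2) by (auto simp: traversal_def)
  then have "finite (range s)" using tr(1) finite_subset unfolding two_regular_def by blast
  then have "\<not> inj s" using finite_imageD infinite_UNIV_int by blast
  then obtain i k where ik: "s i = s k" "i < k" unfolding inj_def by (metis linorder_neqE_linordered_idom)
  \<comment> \<open>Coincidences depend only on the difference of the indices. The return times
    therefore form a group of integers, generated by the least positive one.\<close>
  have sh: "s p = s q \<longleftrightarrow> s (p - q) = s 0" for p q
    using traversal_shift[OF tr, of p q "- q"] traversal_shift[OF tr, of "p - q" 0 q] by auto
  define P where "P = (\<lambda>n::nat. n > 0 \<and> s (int n) = s 0)"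
  have "P (nat (k - i))" using ik sh[of k i] by (simp add: P_def)
  define L where "L = Least P"
  have L: "L > 0" "s (int L) = s 0"
    using LeastI[of P, OF \<open>P (nat (k - i))\<close>] by (auto simp: L_def P_def)
  have mult: "s (int L * int n) = s 0" for n
  proof (induction n)
    case (Suc n)
    have "s (int L * int n + int L) = s (0 + int L)" by (rule traversal_shift[OF tr Suc])
    then show ?case using L(2) by (simp add: algebra_simps)
  qed simp
  have mult': "s (int L * q) = s 0" for q
    using mult[of "nat q"] mult[of "nat (- q)"] sh[of 0 "int L * int (nat (- q))"]
    by (cases "q \<ge> 0") auto
  have zero: "s p = s 0 \<longleftrightarrow> int L dvd p" for p
  proof
    assume p: "s p = s 0"
    have "s (int L * (p div int L) + p mod int L) = s (0 + p mod int L)"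
      by (rule traversal_shift[OF tr mult'])
    then have r: "s (p mod int L) = s 0" using p by (simp add: mult_div_mod_eq)
    have "p mod int L = 0"
    proof (rule ccontr)
      assume "p mod int L \<noteq> 0"
      moreover have "0 \<le> p mod int L" "p mod int L < int L" using L(1) by simp_all
      ultimately have "P (nat (p mod int L))" "nat (p mod int L) < L"
        using r by (simp_all add: P_def nat_less_iff)
      then show False using not_less_Least unfolding L_def by blast
    qed
    then show "int L dvd p" by (simp add: dvd_eq_mod_eq_0)
  qed (auto simp: dvd_def mult')
  have "has_period L s" unfolding has_period_def using sh zero by blast
  then show thesis using that[of L] L(1) by blast
qed

section \<open>Chebyshev entries and traces on one cycle\<close>

text \<open>With \<open>P\<close> the rotation, this is (P + 1/P)(P^(n+1) + 1/P^(n+1)) - (P^n +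
  1/P^n) = P^(n+2) + 1/P^(n+2). The two indicators may hold together, for antipodal vertices or for
  a full turn, and then the entry is 2.\<close>

lemma cheb_traversal:
  assumes "traversal N B s"
  shows "cheb N j (s i) y = of_bool (y = s (i + int j)) + of_bool (y = s (i - int j))"
proof (induction j arbitrary: i rule: less_induct)
  case (less j)
  have *: "N (s j) = {s (j - 1), s (j + 1)}" "s (j - 1) \<noteq> s (j + 1)" for j
    using assms by (simp_all add: traversal_def)
  consider "j = 0" | "j = Suc 0" | n where "j = Suc (Suc n)" by (metis not0_implies_Suc)
  then show ?case
  proof cases
    case 1
    then show ?thesis by auto
  next
    case 2
    then show ?thesis using *[of i] by auto
  next
    case 3
    have "cheb N (Suc n) (s (i - 1)) y = of_bool (y = s (i + int n)) + of_bool (y = s (i - int j))"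
      using less.IH[of "Suc n" "i - 1"] 3 by (simp add: algebra_simps)
    moreover have "cheb N (Suc n) (s (i + 1)) y = of_bool (y = s (i + int j)) + of_bool (y = s (i - int n))"
      using less.IH[of "Suc n" "i + 1"] 3 by (simp add: algebra_simps)
    moreover have "cheb N n (s i) y = of_bool (y = s (i + int n)) + of_bool (y = s (i - int n))"
      using less.IH[of n i] 3 by simp
    ultimately show ?thesis using *[of i] 3 by simp
  qed
qed

lemma cheb_on_cycle:
  assumes "traversal N B s" "has_period L s"
  shows "cheb N j (s i) (s i) = 2 * of_bool (L dvd j)"
proof -
  have "s i = s (i + int j) \<longleftrightarrow> L dvd j" "s i = s (i - int j) \<longleftrightarrow> L dvd j"
    using has_periodD[OF assms(2)] by auto
  then show ?thesis using cheb_traversal[OF assms(1), of j i "s i"] by simp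
qed

lemma range_periodic:
  assumes "L > 0" "has_period L s"
  shows "bij_betw s {0..<int L} (range s)"
proof -
  have "inj_on s {0..<int L}"
  proof
    fix i k assume "i \<in> {0..<int L}" "k \<in> {0..<int L}" "s i = s k"
    then have "int L dvd i - k" "\<bar>i - k\<bar> < int L" using has_periodD[OF assms(2)] by auto
    then show "i = k" using zdvd_not_zless[of "\<bar>i - k\<bar>" "int L"] by (cases "i = k") auto
  qed
  moreover have "s i \<in> s ` {0..<int L}" for i
  proof -
    have "s i = s (i mod int L)" using has_periodD[OF assms(2)] by (simp add: minus_mod_eq_mult_div)
    moreover have "i mod int L \<in> {0..<int L}" using assms(1) by simp
    ultimately show ?thesis by blast
  qed
  ultimately show ?thesis by (auto simp: bij_betw_def)
qed

lemma cheb_trace_cycle: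
  assumes "traversal N B s" "L > 0" "has_period L s"
  shows "(\<Sum>x\<in>range s. cheb N j x x) = real L * (2 * of_bool (L dvd j))"
proof -
  have "(\<Sum>x\<in>range s. cheb N j x x) = (\<Sum>i\<in>{0..<int L}. cheb N j (s i) (s i))"
    by (rule sum.reindex_bij_betw[OF range_periodic[OF assms(2,3)], symmetric])
  also have "\<dots> = real L * (2 * of_bool (L dvd j))"
    by (simp add: cheb_on_cycle[OF assms(1,3)])
  finally show ?thesis .
qed

section \<open>Splitting off, identifying and aligning cycles\<close>

lemma two_regular_diff_cycle:
  assumes "two_regular N B" "traversal N B s"
  shows "two_regular N (B - range s)"
proof -
  have *: "N (s i) = {s (i - 1), s (i + 1)}" for i using assms(2) by (simp add: traversal_def)
  have "N x \<inter> range s = {}" if "x \<in> B - range s" for x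
  proof (rule ccontr)
    assume "N x \<inter> range s \<noteq> {}"
    then obtain i where i: "s i \<in> N x" by blast
    have "s i \<in> B" using assms(2) by (simp add: traversal_def)
    then have "x \<in> N (s i)" using i that assms(1) unfolding two_regular_def by blast
    then show False using *[of i] that by auto
  qed
  then show ?thesis using assms(1) unfolding two_regular_def by blast
qed

lemma cycle_iso:
  assumes "traversal N B s" "traversal N' B' s'"
    and per: "has_period L s" "has_period L s'"
  obtains g where "bij_betw g (range s) (range s')" "\<And>i. g (s i) = s' i"
    "\<And>x y. x \<in> range s \<Longrightarrow> y \<in> range s \<Longrightarrow> y \<in> N x \<longleftrightarrow> g y \<in> N' (g x)"
proof -
  note L = per[THEN has_periodD]
  have *: "N (s i) = {s (i - 1), s (i + 1)}" "N' (s' i) = {s' (i - 1), s' (i + 1)}" for i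
    using assms(1,2) by (simp_all add: traversal_def)
  \<comment> \<open>Any index of \<open>x\<close> will do: two of them differ by a multiple of
    \<open>L\<close>, which is a period of \<open>s'\<close> too.\<close>
  define g where "g = (\<lambda>x. s' (SOME i. s i = x))"
  have g: "g (s i) = s' i" for i
    using someI[of "\<lambda>k. s k = s i" i] L unfolding g_def by simp
  have "inj_on g (range s)" using g L by (auto simp: inj_on_def)
  then have "bij_betw g (range s) (range s')" using g by (auto simp: bij_betw_def image_image)
  moreover have "y \<in> N x \<longleftrightarrow> g y \<in> N' (g x)" if "x \<in> range s" "y \<in> range s" for x y
    using that g * L by auto
  ultimately show thesis using that g by blast
qed

text \<open>Distances from one marked point determine the marked points of a cycle up to reflections; a
  second marked point that is not fixed by the reflection determines the orientation.\<close>

lemma align_traversal: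
  assumes s: "traversal N B s" and s': "traversal N' B' s'"
    and per: "has_period L s" "has_period L s'"
    and 0: "s 0 \<in> T" "\<rho> (s 0) = s' 0"
    and ch: "\<And>j x y. x \<in> T \<Longrightarrow> y \<in> T \<Longrightarrow> cheb N j x y = cheb N' j (\<rho> x) (\<rho> y)"
  obtains s'' where "traversal N' B' s''" "has_period L s''"
    "range s'' = range s'" "\<And>i. s i \<in> T \<Longrightarrow> \<rho> (s i) = s'' i"
proof -
  note L = per[THEN has_periodD]
  \<comment> \<open>The entry is a sum of two nonnegative indicators, so it is nonzero exactly if
    \<open>y\<close> lies at signed distance \<open>i\<close> or \<open>- i\<close>. The equality of
    entries transfers this alternative.\<close>
  have ch': "(\<rho> y = s' (p + i) \<or> \<rho> y = s' (p - i)) \<longleftrightarrow> (y = s (q + i) \<or> y = s (q - i))"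
    if "s q \<in> T" "\<rho> (s q) = s' p" "y \<in> T" for y p q i
  proof -
    have "cheb N (nat \<bar>i\<bar>) (s q) y = cheb N' (nat \<bar>i\<bar>) (s' p) (\<rho> y)" using ch that by metis
    then show ?thesis
      unfolding cheb_traversal[OF s] cheb_traversal[OF s'] of_bool_def
      by (cases "i \<ge> 0") (auto split: if_splits)
  qed
  have pm: "\<rho> (s i) = s' i \<or> \<rho> (s i) = s' (- i)" if "s i \<in> T" for i
    using ch'[OF 0 that, of i] by simp
  \<comment> \<open>A marked \<open>s k\<close> that the reflection moves fixes the orientation
    \<open>t\<close>. Distance from 0 leaves \<open>t i\<close> or \<open>t (- i)\<close> as the
    image of \<open>s i\<close>, distance from \<open>k\<close> leaves \<open>t i\<close> or
    \<open>t (2 * k - i)\<close>. The second choices agree only if \<open>L\<close> divides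
    \<open>2 * k\<close>.\<close>
  have det: "\<rho> (s i) = t i"
    if k: "s k \<in> T" "\<rho> (s k) = t k" "\<not> int L dvd 2 * k" and i: "s i \<in> T"
      and t: "t = s' \<or> t = (\<lambda>i. s' (- i))" for i k t
  proof -
    have tL: "t i = t k \<longleftrightarrow> int L dvd i - k" for i k
      using t L(2)[of i k] L(2)[of "- i" "- k"] dvd_diff_commute[of "int L" i k] by auto
    have "\<rho> (s i) = t (k + (i - k)) \<or> \<rho> (s i) = t (k - (i - k))"
      using t
    proof
      assume "t = s'"
      then show ?thesis using ch'[of k k "s i" "i - k"] k i by simp
    next
      assume "t = (\<lambda>i. s' (- i))"
      then show ?thesis using ch'[of k "- k" "s i" "i - k"] k i by (auto simp: algebra_simps)
    qed
    moreover have "\<rho> (s i) = t i \<or> \<rho> (s i) = t (- i)" using pm[OF i] t by auto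
    moreover have "int L dvd 2 * k" if "t (- i) = t (k - (i - k))"
      using that tL by (simp add: algebra_simps dvd_minus_iff)
    ultimately show ?thesis using k(3) by (auto simp: algebra_simps)
  qed
  show thesis
  proof (cases "\<exists>k. s k \<in> T \<and> \<rho> (s k) = s' (- k) \<and> \<not> int L dvd 2 * k")
    case True
    then obtain k where k: "s k \<in> T" "\<rho> (s k) = s' (- k)" "\<not> int L dvd 2 * k" by blast
    have "s' i \<in> range (\<lambda>i. s' (- i))" for i by (rule range_eqI[of _ _ "- i"]) simp
    then have rg: "range (\<lambda>i. s' (- i)) = range s'" by auto
    have "- i - - k = k - i" for i k :: int by simp
    then have "s' (- i) = s' (- k) \<longleftrightarrow> int L dvd i - k" for i k
      using L(2) by (simp add: dvd_diff_commute)
    then have "has_period L (\<lambda>i. s' (- i))" by (simp add: has_period_def)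
    then show ?thesis
      using that[of "\<lambda>i. s' (- i)"] traversal_uminus[OF s'] rg det[OF k(1), of "\<lambda>i. s' (- i)"] k by blast
  next
    case False
    \<comment> \<open>Every marked point that is sent to its mirror position is now fixed by the
      reflection, so \<open>s'\<close> itself fits all marked points.\<close>
    have "\<rho> (s i) = s' i" if "s i \<in> T" for i
    proof (cases "int L dvd 2 * i")
      case True
      then have "s' i = s' (- i)" using L(2) by simp
      then show ?thesis using pm[OF that] by simp
    next
      case F: False
      then show ?thesis using False pm[OF that] that by blast
    qed
    then show ?thesis using that[of s'] s' per by blast
  qed
qed


section \<open>Isomorphism of 2-regular graphs with marked vertices\<close>

text \<open>Nonnegativity rules out cancellation between cycles: a trace vanishes only if every
  diagonal entry does.\<close>

lemma positive_diagonal_cheb: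
  assumes "two_regular N B" "x \<in> B"
  shows "cheb N j x x \<ge> 0" "\<exists>j>0. cheb N j x x \<noteq> 0"
proof -
  obtain s where s: "traversal N B s" "s 0 = x" using traversal_exists[OF assms] .
  obtain L where L: "L > 0" "has_period L s"
    using traversal_period[OF assms(1) s(1)] by blast
  note * = cheb_on_cycle[OF s(1) L(2), of _ 0, unfolded s(2)]
  show "cheb N j x x \<ge> 0" unfolding * by simp
  show "\<exists>j>0. cheb N j x x \<noteq> 0" unfolding * using L(1) by (intro exI[of _ L]) auto
qed

text \<open>A nonzero trace at \<open>j\<close> exhibits a cycle whose length divides
  \<open>j\<close>. A proper divisor would already give a nonzero trace earlier. Thus the traces
  alone reveal the length of a shortest cycle.\<close>

lemma shortest_cycle:
  assumes "two_regular N B" "j > 0" "(\<Sum>x\<in>B. cheb N j x x) \<noteq> 0"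
    and min: "\<And>i. 0 < i \<Longrightarrow> i < j \<Longrightarrow> (\<Sum>x\<in>B. cheb N i x x) = 0"
  obtains s where "traversal N B s" "has_period j s"
proof -
  have fin: "finite B" using assms(1) by (simp add: two_regular_def)
  obtain x where x: "x \<in> B" "cheb N j x x \<noteq> 0" using assms(3) by (meson sum.neutral)
  obtain s where s: "traversal N B s" "s 0 = x" using traversal_exists[OF assms(1) x(1)] .
  obtain L where L: "L > 0" "has_period L s"
    using traversal_period[OF assms(1) s(1)] by blast
  note * = cheb_on_cycle[OF s(1) L(2), of _ 0, unfolded s(2)]
  have "L dvd j" using x(2) unfolding * by simp
  then have "L \<le> j" using assms(2) by (rule dvd_imp_le)
  moreover have "\<not> L < j"
  proof
    assume "L < j"
    then have "\<forall>x\<in>B. cheb N L x x = 0"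
      using min[OF L(1)] sum_nonneg_eq_0_iff[OF fin, of "\<lambda>x. cheb N L x x"]
        positive_diagonal_cheb(1)[OF assms(1)] by simp
    then show False using * x(1) by auto
  qed
  ultimately have "L = j" by simp
  then show thesis using that s(1) L(2) by blast
qed

text \<open>On either side no edge joins the matched cycle to the remainder, so the two partial
  isomorphisms are independent of each other.\<close>

lemma glue_iso:
  assumes C: "C \<subseteq> B" "C' \<subseteq> B'" "bij_betw g C C'" "bij_betw f (B - C) (B' - C')"
    and g: "\<And>x y. x \<in> C \<Longrightarrow> y \<in> C \<Longrightarrow> y \<in> N x \<longleftrightarrow> g y \<in> N' (g x)"
    and f: "\<And>x y. x \<in> B - C \<Longrightarrow> y \<in> B - C \<Longrightarrow> y \<in> N x \<longleftrightarrow> f y \<in> N' (f x)"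
    and N: "\<And>x. x \<in> C \<Longrightarrow> N x \<subseteq> C" "\<And>x. x \<in> B - C \<Longrightarrow> N x \<subseteq> B - C"
    and N': "\<And>x. x \<in> C' \<Longrightarrow> N' x \<subseteq> C'" "\<And>x. x \<in> B' - C' \<Longrightarrow> N' x \<subseteq> B' - C'"
    and h: "\<And>x. x \<in> C \<Longrightarrow> h x = g x" "\<And>x. x \<notin> C \<Longrightarrow> h x = f x"
  shows "bij_betw h B B'" "\<And>x y. x \<in> B \<Longrightarrow> y \<in> B \<Longrightarrow> y \<in> N x \<longleftrightarrow> h y \<in> N' (h x)"
proof -
  have "bij_betw h C C'" using C(3) h(1) by (simp cong: bij_betw_cong)
  moreover have "bij_betw h (B - C) (B' - C')"
    using C(4) bij_betw_cong[of "B - C" h f] h(2) by simp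
  ultimately have "bij_betw h (C \<union> (B - C)) (C' \<union> (B' - C'))"
    by (rule bij_betw_combine) simp
  moreover have "C \<union> (B - C) = B" "C' \<union> (B' - C') = B'" using C by auto
  ultimately show "bij_betw h B B'" by simp
  have mem: "h x \<in> C'" if "x \<in> C" for x using that C(3) h(1) by (auto simp: bij_betw_def)
  have nmem: "h x \<in> B' - C'" if "x \<in> B - C" for x
    using that C(4) h(2) by (auto simp: bij_betw_def)
  show "y \<in> N x \<longleftrightarrow> h y \<in> N' (h x)" if xy: "x \<in> B" "y \<in> B" for x y
  proof -
    consider "x \<in> C" "y \<in> C" | "x \<in> C" "y \<in> B - C" | "x \<in> B - C" "y \<in> C"
      | "x \<in> B - C" "y \<in> B - C" using xy by blast
    then show ?thesis
    proof cases
      case 1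
      then show ?thesis using g h(1) by simp
    next
      case 2
      then show ?thesis using mem[of x] nmem[of y] N(1)[of x] N'(1)[of "h x"] by blast
    next
      case 3
      then show ?thesis using mem[of y] nmem[of x] N(2)[of x] N'(2)[of "h x"] by blast
    next
      case 4
      then show ?thesis using f h(2) by simp
    qed
  qed
qed

text \<open>Traces of the Chebyshev matrices count the cycles of each length, and their entries at
  marked vertices record the cyclic distances between them; matching the cycles one at a time
  proves the claim.\<close>

lemma two_regular_iso:
  assumes "two_regular N B" "two_regular N' B'" "T \<subseteq> B" "\<rho> ` T \<subseteq> B'"
    and ch: "\<And>j x y. x \<in> T \<Longrightarrow> y \<in> T \<Longrightarrow> cheb N j x y = cheb N' j (\<rho> x) (\<rho> y)"
    and tr: "\<And>j. (\<Sum>x\<in>B. cheb N j x x) = (\<Sum>x\<in>B'. cheb N' j x x)"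
  shows "\<exists>f. bij_betw f B B' \<and> (\<forall>x\<in>T. f x = \<rho> x) \<and>
    (\<forall>x\<in>B. \<forall>y\<in>B. y \<in> N x \<longleftrightarrow> f y \<in> N' (f x))"
  using assms
proof (induction "card B" arbitrary: B B' T rule: less_induct)
  case less
  note B = less.prems(1) and B' = less.prems(2) and T = less.prems(3,4)
    and ch = less.prems(5) and tr = less.prems(6)
  have fin: "finite B" "finite B'" using B B' by (simp_all add: two_regular_def)
  \<comment> \<open>At index 0 the trace is twice the number of vertices.\<close>
  have "(\<Sum>x\<in>B. cheb N 0 x x) = (\<Sum>x\<in>B'. cheb N' 0 x x)" by (rule tr)
  then have card: "card B = card B'" by simp
  show ?case
  proof (cases "B = {}")
    case True
    then have "B' = {}" using card fin by simp
    then show ?thesis using True T by (auto simp: bij_betw_def)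
  next
    case False
    \<comment> \<open>One pair of cycles to be matched. It starts at a marked vertex if there is one
      and is a pair of shortest cycles otherwise. The last conjunct keeps images of the remaining
      marked vertices off the matched cycle, as the induction hypothesis for the remainder
      demands.\<close>
    have "\<exists>s s' L. L > 0 \<and> traversal N B s \<and> traversal N' B' s' \<and>
      has_period L s \<and> has_period L s' \<and>
      (\<forall>i. s i \<in> T \<longrightarrow> \<rho> (s i) = s' i) \<and> (\<forall>y\<in>T. \<rho> y \<in> range s' \<longrightarrow> y \<in> range s)"
    proof (cases "T = {}")
      case True
      obtain x where x: "x \<in> B" using False by blast
      define P where "P = (\<lambda>j. j > 0 \<and> (\<Sum>x\<in>B. cheb N j x x) \<noteq> 0)"
      obtain j0 where j0: "j0 > 0" "cheb N j0 x x \<noteq> 0"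
        using positive_diagonal_cheb(2)[OF B x] by blast
      have "P j0"
        unfolding P_def using j0 x sum_nonneg_eq_0_iff[OF fin(1), of "\<lambda>x. cheb N j0 x x"]
          positive_diagonal_cheb(1)[OF B] by auto
      define j where "j = Least P"
      have "P j" using LeastI[of P, OF \<open>P j0\<close>] by (simp add: j_def)
      moreover have "\<not> P i" if "i < j" for i using that not_less_Least unfolding j_def by blast
      ultimately have j: "j > 0" "(\<Sum>x\<in>B. cheb N j x x) \<noteq> 0"
        "\<And>i. 0 < i \<Longrightarrow> i < j \<Longrightarrow> (\<Sum>x\<in>B. cheb N i x x) = 0"
        by (auto simp: P_def)
      obtain s where s: "traversal N B s" "has_period j s"
        by (rule shortest_cycle[OF B j])
      obtain s' where s': "traversal N' B' s'" "has_period j s'"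
        by (rule shortest_cycle[OF B' j[unfolded tr]])
      show ?thesis using s s' j(1) True by blast
    next
      case False
      then obtain x where x: "x \<in> T" by blast
      then have xB: "x \<in> B" "\<rho> x \<in> B'" using T by auto
      obtain s where s: "traversal N B s" "s 0 = x" using traversal_exists[OF B xB(1)] .
      obtain L where L: "L > 0" "has_period L s"
        using traversal_period[OF B s(1)] by blast
      obtain s' where s': "traversal N' B' s'" "s' 0 = \<rho> x" using traversal_exists[OF B' xB(2)] .
      obtain L' where L': "L' > 0" "has_period L' s'"
        using traversal_period[OF B' s'(1)] by blast
      have "cheb N j x x = cheb N' j (\<rho> x) (\<rho> x)" for j using ch x by blast
      then have "L dvd j \<longleftrightarrow> L' dvd j" for j
        using cheb_on_cycle[OF s(1) L(2), of j 0] cheb_on_cycle[OF s'(1) L'(2), of j 0] s(2) s'(2)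
        by (metis (no_types, lifting) of_bool_eq_iff mult_cancel_left zero_neq_numeral)
      then have "L = L'" by (metis dvd_antisym dvd_refl)
      note L'2 = L'(2)[folded this]
      obtain s'' where s'': "traversal N' B' s''" "has_period L s''"
        "range s'' = range s'" "\<And>i. s i \<in> T \<Longrightarrow> \<rho> (s i) = s'' i"
        using align_traversal[OF s(1) s'(1) L(2) L'2, of T \<rho>] x s(2) s'(2) ch by auto
      \<comment> \<open>The image of \<open>y\<close> has a nonzero entry with the image of
        \<open>x\<close> at their distance along the cycle. Transferred back, that entry puts
        \<open>y\<close> on the cycle of \<open>x\<close>.\<close>
      have "y \<in> range s" if y: "y \<in> T" "\<rho> y \<in> range s''" for y
      proof -
        obtain i where i: "\<rho> y = s' i" using y s''(3) by auto
        have "cheb N' (nat \<bar>i\<bar>) (\<rho> x) (\<rho> y) \<noteq> 0"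
          using cheb_traversal[OF s'(1), of "nat \<bar>i\<bar>" 0 "\<rho> y"] s'(2) i by (cases "i \<ge> 0") auto
        then have "cheb N (nat \<bar>i\<bar>) (s 0) y \<noteq> 0" using ch x y s(2) by simp
        then show ?thesis using cheb_traversal[OF s(1)] by (auto split: if_splits simp: of_bool_def)
      qed
      then show ?thesis using L s(1) s'' by blast
    qed
    then obtain s s' L where L: "L > 0" and s: "traversal N B s" and s': "traversal N' B' s'"
      and sL: "has_period L s" and s'L: "has_period L s'"
      and sT: "\<And>i. s i \<in> T \<Longrightarrow> \<rho> (s i) = s' i" and Ts: "\<And>y. y \<in> T \<Longrightarrow> \<rho> y \<in> range s' \<Longrightarrow> y \<in> range s"
      by blast
    have sub: "range s \<subseteq> B" "range s' \<subseteq> B'" using s s' by (auto simp: traversal_def)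
    obtain g where g: "bij_betw g (range s) (range s')" "\<And>i. g (s i) = s' i"
      "\<And>x y. x \<in> range s \<Longrightarrow> y \<in> range s \<Longrightarrow> y \<in> N x \<longleftrightarrow> g y \<in> N' (g x)"
      using cycle_iso[OF s s' sL s'L] by metis
    have reg: "two_regular N (B - range s)" "two_regular N' (B' - range s')"
      using two_regular_diff_cycle B B' s s' by blast+
    have less: "card (B - range s) < card B"
    proof (rule psubset_card_mono[OF fin(1)])
      show "B - range s \<subset> B" using sub(1) by (metis Diff_subset Diff_iff psubsetI rangeI subsetD)
    qed
    have Tsub: "T - range s \<subseteq> B - range s" "\<rho> ` (T - range s) \<subseteq> B' - range s'"
    proof -
      show "T - range s \<subseteq> B - range s" using T(1) by (rule Diff_mono) simp
      show "\<rho> ` (T - range s) \<subseteq> B' - range s'"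
      proof (rule image_subsetI)
        fix x assume x: "x \<in> T - range s"
        then have "\<rho> x \<in> B'" "\<rho> x \<notin> range s'" using T(2) Ts[of x] by auto
        then show "\<rho> x \<in> B' - range s'" by simp
      qed
    qed
    have tr': "(\<Sum>x\<in>B - range s. cheb N j x x) = (\<Sum>x\<in>B' - range s'. cheb N' j x x)" for j
      unfolding sum_diff[OF fin(1) sub(1)] sum_diff[OF fin(2) sub(2)] tr
        cheb_trace_cycle[OF s L sL] cheb_trace_cycle[OF s' L s'L] ..
    have ch': "cheb N j x y = cheb N' j (\<rho> x) (\<rho> y)"
      if "x \<in> T - range s" "y \<in> T - range s" for j x y using that ch by blast
    obtain f where f: "bij_betw f (B - range s) (B' - range s')"
      "\<And>x. x \<in> T - range s \<Longrightarrow> f x = \<rho> x"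
      "\<And>x y. x \<in> B - range s \<Longrightarrow> y \<in> B - range s \<Longrightarrow> y \<in> N x \<longleftrightarrow> f y \<in> N' (f x)"
      using less.hyps[OF less reg Tsub ch' tr'] by blast
    define h where "h = (\<lambda>x. if x \<in> range s then g x else f x)"
    have h: "h x = g x" if "x \<in> range s" for x using that by (simp add: h_def)
    have h': "h x = f x" if "x \<notin> range s" for x using that by (simp add: h_def)
    have nb: "N x \<subseteq> range s" if "x \<in> range s" for x using that s by (auto simp: traversal_def)
    have nb': "N' x \<subseteq> range s'" if "x \<in> range s'" for x using that s' by (auto simp: traversal_def)
    have nc: "N x \<subseteq> B - range s" if "x \<in> B - range s" for x
      using that reg(1) by (simp add: two_regular_def)
    have nc': "N' x \<subseteq> B' - range s'" if "x \<in> B' - range s'" for x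
      using that reg(2) by (simp add: two_regular_def)
    note glue = glue_iso[OF sub g(1) f(1) g(3) f(3) nb nc nb' nc' h h']
    have "h x = \<rho> x" if "x \<in> T" for x
    proof (cases "x \<in> range s")
      case True
      then obtain i where "x = s i" by auto
      then show ?thesis using sT that g(2) h True by simp
    next
      case False
      then show ?thesis using that f(2) h' by simp
    qed
    then show ?thesis using glue by blast
  qed
qed

section \<open>Intertwined adjacency matrices\<close>

text \<open>Functions on index sets, unlike matrices, restrict to sub-blocks without reindexing.
  Both products are prescribed because \<open>B\<close> and \<open>B'\<close> are not presumed to
  have equal size.\<close>

definition orthogonal_on :: "'a set \<Rightarrow> 'b set \<Rightarrow> ('a \<Rightarrow> 'b \<Rightarrow> real) \<Rightarrow> bool" where
  "orthogonal_on B B' r \<longleftrightarrow> finite B \<and> finite B' \<and>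
     (\<forall>i\<in>B. \<forall>j\<in>B. (\<Sum>k\<in>B'. r i k * r j k) = of_bool (i = j)) \<and>
     (\<forall>k\<in>B'. \<forall>l\<in>B'. (\<Sum>i\<in>B. r i k * r i l) = of_bool (k = l))"

definition intertwines :: "'a set \<Rightarrow> 'b set \<Rightarrow> ('a \<Rightarrow> 'b \<Rightarrow> real) \<Rightarrow> ('a \<Rightarrow> 'a \<Rightarrow> real) \<Rightarrow> ('b \<Rightarrow> 'b \<Rightarrow> real) \<Rightarrow> bool" where
  "intertwines B B' r a b \<longleftrightarrow>
     (\<forall>i\<in>B. \<forall>k\<in>B'. (\<Sum>j\<in>B'. r i j * b j k) = (\<Sum>j\<in>B. a i j * r j k))"

lemma orthogonal_on_transpose: "orthogonal_on B B' r \<Longrightarrow> orthogonal_on B' B (\<lambda>k i. r i k)"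
  by (auto simp: orthogonal_on_def)

lemma orthogonal_on_inner:
  assumes "orthogonal_on B B' r"
  shows "(\<Sum>k\<in>B'. (\<Sum>i\<in>B. v i * r i k) * (\<Sum>i\<in>B. w i * r i k)) = (\<Sum>i\<in>B. v i * w i)"
proof -
  have fin: "finite B" using assms by (simp add: orthogonal_on_def)
  have "(\<Sum>k\<in>B'. (\<Sum>i\<in>B. v i * r i k) * (\<Sum>i\<in>B. w i * r i k)) =
      (\<Sum>k\<in>B'. \<Sum>i\<in>B. \<Sum>j\<in>B. v i * w j * (r i k * r j k))"
    by (simp add: sum_product algebra_simps)
  also have "\<dots> = (\<Sum>i\<in>B. \<Sum>j\<in>B. \<Sum>k\<in>B'. v i * w j * (r i k * r j k))"
    by (subst sum.swap, rule sum.cong[OF refl], rule sum.swap)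
  also have "\<dots> = (\<Sum>i\<in>B. \<Sum>j\<in>B. v i * w j * of_bool (i = j))"
    using assms by (simp add: orthogonal_on_def sum_distrib_left[symmetric])
  also have "\<dots> = (\<Sum>i\<in>B. v i * w i)"
    using fin by (intro sum.cong refl) (simp add: of_bool_def if_distrib cong: if_cong)
  finally show ?thesis .
qed

text \<open>Both cardinalities are the sum of the squares of all entries, taken by rows and by
  columns.\<close>

lemma orthogonal_on_card:
  assumes "orthogonal_on B B' r"
  shows "card B = card B'"
proof -
  have "real (card B) = (\<Sum>i\<in>B. \<Sum>k\<in>B'. r i k * r i k)"
    using assms by (simp add: orthogonal_on_def)
  also have "\<dots> = (\<Sum>k\<in>B'. \<Sum>i\<in>B. r i k * r i k)" by (rule sum.swap)
  also have "\<dots> = real (card B')" using assms by (simp add: orthogonal_on_def)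
  finally show ?thesis by simp
qed

text \<open>Insert r r^T = 1 after \<open>a\<close>, replace a r by r b, and move r^T round the
  trace.\<close>

lemma orthogonal_on_trace:
  assumes r: "orthogonal_on B B' r" and i: "intertwines B B' r a b"
  shows "(\<Sum>i\<in>B. a i i) = (\<Sum>k\<in>B'. b k k)"
proof -
  have fin: "finite B" "finite B'" using r by (simp_all add: orthogonal_on_def)
  have "(\<Sum>i\<in>B. a i i) = (\<Sum>i\<in>B. \<Sum>j\<in>B. a i j * of_bool (i = j))"
    using fin by (intro sum.cong refl) (simp add: of_bool_def if_distrib cong: if_cong)
  also have "\<dots> = (\<Sum>i\<in>B. \<Sum>j\<in>B. a i j * (\<Sum>k\<in>B'. r i k * r j k))"
    using r by (simp add: orthogonal_on_def)
  also have "\<dots> = (\<Sum>i\<in>B. \<Sum>j\<in>B. \<Sum>k\<in>B'. a i j * r j k * r i k)"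
    by (simp add: sum_distrib_left algebra_simps)
  also have "\<dots> = (\<Sum>i\<in>B. \<Sum>k\<in>B'. \<Sum>j\<in>B. a i j * r j k * r i k)"
    by (rule sum.cong[OF refl], rule sum.swap)
  also have "\<dots> = (\<Sum>i\<in>B. \<Sum>k\<in>B'. (\<Sum>j\<in>B'. r i j * b j k) * r i k)"
    using i by (simp add: intertwines_def sum_distrib_right[symmetric])
  also have "\<dots> = (\<Sum>k\<in>B'. \<Sum>j\<in>B'. \<Sum>i\<in>B. b j k * (r i j * r i k))"
    by (subst sum.swap, rule sum.cong[OF refl], subst sum.swap, simp add: sum_distrib_right sum_distrib_left algebra_simps)
  also have "\<dots> = (\<Sum>k\<in>B'. \<Sum>j\<in>B'. b j k * of_bool (j = k))"
    using r by (simp add: orthogonal_on_def sum_distrib_left[symmetric])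
  also have "\<dots> = (\<Sum>k\<in>B'. b k k)"
    using fin by (intro sum.cong refl) (simp add: of_bool_def if_distrib cong: if_cong)
  finally show ?thesis .
qed

lemma sum_subset_of_bool:
  fixes f :: "'a \<Rightarrow> real"
  assumes "finite B" "S \<subseteq> B"
  shows "(\<Sum>z\<in>B. of_bool (z \<in> S) * f z) = sum f S"
proof -
  have "(\<Sum>z\<in>B. of_bool (z \<in> S) * f z) = (\<Sum>z\<in>B. if z \<in> S then f z else 0)"
    by (rule sum.cong) auto
  also have "\<dots> = sum f (B \<inter> S)" using assms(1) by (rule sum.inter_restrict[symmetric])
  also have "B \<inter> S = S" using assms(2) by blast
  finally show ?thesis .
qed

text \<open>Intertwining passes to polynomials of the matrices. Closure of the sets under neighbours
  makes the sum over \<open>N x\<close> in the recursion a matrix product.\<close>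

lemma intertwines_cheb:
  assumes r: "finite B" "finite B'"
    and N: "\<And>x. x \<in> B \<Longrightarrow> N x \<subseteq> B" "\<And>x. x \<in> B' \<Longrightarrow> N' x \<subseteq> B'"
    and i: "intertwines B B' r (\<lambda>x y. of_bool (y \<in> N x)) (\<lambda>x y. of_bool (y \<in> N' x))"
  shows "intertwines B B' r (cheb N n) (cheb N' n)"
proof (induction n rule: less_induct)
  case (less n)
  consider "n = 0" | "n = Suc 0" | m where "n = Suc (Suc m)" by (metis not0_implies_Suc)
  then show ?case
  proof cases
    case 1
    have "(\<Sum>j\<in>B'. r i j * cheb N' 0 j k) = 2 * r i k" if "k \<in> B'" for i k
      using that r by (simp add: of_bool_def if_distrib cong: if_cong)
    moreover have "(\<Sum>j\<in>B. cheb N 0 i j * r j k) = 2 * r i k" if "i \<in> B" for i k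
      using that r by (simp add: of_bool_def if_distrib if_distribR cong: if_cong)
    ultimately show ?thesis using 1 unfolding intertwines_def by metis
  next
    case 2
    then show ?thesis using i by (simp add: intertwines_def)
  next
    case 3
    let ?a = "\<lambda>x y. of_bool (y \<in> N x) :: real" and ?b = "\<lambda>x y. of_bool (y \<in> N' x) :: real"
    have IH: "(\<Sum>j\<in>B'. r i j * cheb N' k j l) = (\<Sum>j\<in>B. cheb N k i j * r j l)"
      if "k \<in> {m, Suc m}" "i \<in> B" "l \<in> B'" for k i l
      using less.IH[of k] 3 that unfolding intertwines_def by auto
    have "(\<Sum>j\<in>B'. r i j * cheb N' n j k) = (\<Sum>j\<in>B. cheb N n i j * r j k)"
      if ik: "i \<in> B" "k \<in> B'" for i k
    proof -
      have "(\<Sum>j\<in>B'. r i j * (\<Sum>z\<in>N' j. cheb N' (Suc m) z k)) =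
          (\<Sum>j\<in>B'. r i j * (\<Sum>z\<in>B'. ?b j z * cheb N' (Suc m) z k))"
        using N(2) sum_subset_of_bool[OF r(2)] by (intro sum.cong refl) simp
      also have "\<dots> = (\<Sum>j\<in>B'. \<Sum>z\<in>B'. r i j * ?b j z * cheb N' (Suc m) z k)"
        by (simp only: sum_distrib_left mult.assoc)
      also have "\<dots> = (\<Sum>z\<in>B'. (\<Sum>j\<in>B'. r i j * ?b j z) * cheb N' (Suc m) z k)"
        by (subst sum.swap) (simp only: sum_distrib_right)
      also have "\<dots> = (\<Sum>z\<in>B'. (\<Sum>j\<in>B. ?a i j * r j z) * cheb N' (Suc m) z k)"
        using i ik unfolding intertwines_def by (intro sum.cong refl) metis
      also have "\<dots> = (\<Sum>z\<in>B'. \<Sum>j\<in>B. ?a i j * (r j z * cheb N' (Suc m) z k))"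
        by (simp only: sum_distrib_right mult.assoc)
      also have "\<dots> = (\<Sum>j\<in>B. ?a i j * (\<Sum>z\<in>B'. r j z * cheb N' (Suc m) z k))"
        by (subst sum.swap) (simp only: sum_distrib_left)
      also have "\<dots> = (\<Sum>j\<in>B. ?a i j * (\<Sum>z\<in>B. cheb N (Suc m) j z * r z k))"
        using IH ik by (intro sum.cong refl) simp
      also have "\<dots> = (\<Sum>j\<in>B. \<Sum>z\<in>B. ?a i j * cheb N (Suc m) j z * r z k)"
        by (simp only: sum_distrib_left mult.assoc)
      also have "\<dots> = (\<Sum>z\<in>B. (\<Sum>j\<in>B. ?a i j * cheb N (Suc m) j z) * r z k)"
        by (subst sum.swap) (simp only: sum_distrib_right)
      also have "\<dots> = (\<Sum>z\<in>B. (\<Sum>j\<in>N i. cheb N (Suc m) j z) * r z k)"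
        using N(1) ik sum_subset_of_bool[OF r(1)] by (intro sum.cong refl) simp
      finally show ?thesis
        using IH[of m i k] ik 3 by (simp add: algebra_simps sum_subtractf)
    qed
    then show ?thesis by (simp add: intertwines_def)
  qed
qed

text \<open>Both graphs have the same number of edges, so the image of the all-one vector attains the
  largest eigenvalue 2 of the first graph and is an eigenvector.\<close>

lemma two_regular_intertwined:
  assumes B: "two_regular N B"
    and N': "\<And>x. x \<in> B' \<Longrightarrow> N' x \<subseteq> B' \<and> x \<notin> N' x"
      "\<And>x y. x \<in> B' \<Longrightarrow> y \<in> B' \<Longrightarrow> y \<in> N' x \<longleftrightarrow> x \<in> N' y"
    and r: "orthogonal_on B B' r"
    and i: "intertwines B B' r (\<lambda>x y. of_bool (y \<in> N x)) (\<lambda>x y. of_bool (y \<in> N' x))"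
  shows "two_regular N' B'"
proof -
  have fin: "finite B" "finite B'" using r by (simp_all add: orthogonal_on_def)
  define a where "a = (\<lambda>x y. of_bool (y \<in> N x) :: real)"
  define b where "b = (\<lambda>x y. of_bool (y \<in> N' x) :: real)"
  have int: "(\<Sum>j\<in>B'. r i j * b j k) = (\<Sum>j\<in>B. a i j * r j k)" if "i \<in> B" "k \<in> B'" for i k
    using i that by (simp add: intertwines_def a_def b_def)
  have a2: "(\<Sum>j\<in>B. a i j) = 2" if "i \<in> B" for i
  proof -
    have "N i \<subseteq> B" "card (N i) = 2" using B that by (simp_all add: two_regular_def)
    then show ?thesis using sum_subset_of_bool[OF fin(1), of "N i" "\<lambda>_. 1"] by (simp add: a_def)
  qed
  have asym: "a x y = a y x" if "x \<in> B" "y \<in> B" for x y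
    using B that unfolding a_def two_regular_def by simp
  have bsym: "b x y = b y x" if "x \<in> B'" "y \<in> B'" for x y
    using N'(2)[OF that] unfolding b_def by simp
  define d where "d = (\<lambda>k. \<Sum>l\<in>B'. b k l)"
  have card: "card B = card B'" using r by (rule orthogonal_on_card)
  note rt = orthogonal_on_transpose[OF r]
  \<comment> \<open>For a 0/1 matrix the sum of the entries equals the sum of their squares, and the
    latter is invariant under orthogonal transformations.\<close>
  have "(\<Sum>k\<in>B'. d k) = (\<Sum>k\<in>B'. \<Sum>l\<in>B'. b l k * b l k)"
    unfolding d_def by (subst sum.swap) (auto simp: b_def of_bool_def intro!: sum.cong)
  also have "\<dots> = (\<Sum>k\<in>B'. \<Sum>i\<in>B. (\<Sum>l\<in>B'. b l k * r i l) * (\<Sum>l\<in>B'. b l k * r i l))"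
    using orthogonal_on_inner[OF rt] by (intro sum.cong refl) (rule sym)
  also have "\<dots> = (\<Sum>k\<in>B'. \<Sum>i\<in>B. (\<Sum>j\<in>B. a i j * r j k) * (\<Sum>j\<in>B. a i j * r j k))"
    using int by (intro sum.cong refl) (simp add: mult.commute)
  also have "\<dots> = (\<Sum>i\<in>B. \<Sum>k\<in>B'. (\<Sum>j\<in>B. a i j * r j k) * (\<Sum>j\<in>B. a i j * r j k))"
    by (rule sum.swap)
  also have "\<dots> = (\<Sum>i\<in>B. \<Sum>j\<in>B. a i j * a i j)"
    using orthogonal_on_inner[OF r] by (intro sum.cong refl)
  also have "\<dots> = (\<Sum>i\<in>B. \<Sum>j\<in>B. a i j)"
    by (auto simp: a_def of_bool_def intro!: sum.cong)
  also have "\<dots> = 2 * real (card B)" using a2 by simp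
  finally have dsum: "(\<Sum>k\<in>B'. d k) = 2 * real (card B)" .
  define u where "u = (\<lambda>i. \<Sum>k\<in>B'. r i k)"
  have uu: "(\<Sum>i\<in>B. u i * u i) = real (card B)"
    using orthogonal_on_inner[OF rt, of "\<lambda>_. 1" "\<lambda>_. 1"] card by (simp add: u_def)
  have au: "(\<Sum>j\<in>B. a i j * u j) = (\<Sum>l\<in>B'. d l * r i l)" if "i \<in> B" for i
  proof -
    have "(\<Sum>j\<in>B. a i j * u j) = (\<Sum>k\<in>B'. \<Sum>j\<in>B. a i j * r j k)"
      unfolding u_def sum_distrib_left by (rule sum.swap)
    also have "\<dots> = (\<Sum>k\<in>B'. \<Sum>j\<in>B'. r i j * b j k)" using int that by simp
    also have "\<dots> = (\<Sum>j\<in>B'. d j * r i j)"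
      unfolding d_def sum_distrib_right by (subst sum.swap) (simp add: mult.commute)
    finally show ?thesis .
  qed
  have "(\<Sum>i\<in>B. u i * (\<Sum>j\<in>B. a i j * u j)) = (\<Sum>i\<in>B. (\<Sum>k\<in>B'. 1 * r i k) * (\<Sum>l\<in>B'. d l * r i l))"
    using au by (simp add: u_def)
  also have "\<dots> = 2 * real (card B)"
    using orthogonal_on_inner[OF rt, of "\<lambda>_. 1" d] dsum by simp
  finally have uau: "(\<Sum>i\<in>B. u i * (\<Sum>j\<in>B. a i j * u j)) = 2 * real (card B)" .
  \<comment> \<open>Twice the Laplacian form of the first graph at \<open>u\<close>. By
    \<open>uu\<close> and \<open>uau\<close> it equals 4 card B - 4 card B = 0, so \<open>u\<close>
    is constant along edges.\<close>
  have "(\<Sum>i\<in>B. \<Sum>j\<in>B. a i j * (u i - u j)\<^sup>2) =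
      (\<Sum>i\<in>B. \<Sum>j\<in>B. a i j * (u i * u i)) + (\<Sum>i\<in>B. \<Sum>j\<in>B. a i j * (u j * u j))
        - 2 * (\<Sum>i\<in>B. u i * (\<Sum>j\<in>B. a i j * u j))"
    unfolding sum_distrib_left sum.distrib[symmetric] sum_subtractf[symmetric]
    by (intro sum.cong refl) (simp add: power2_eq_square algebra_simps)
  also have "(\<Sum>i\<in>B. \<Sum>j\<in>B. a i j * (u i * u i)) = 2 * (\<Sum>i\<in>B. u i * u i)"
    unfolding sum_distrib_right[symmetric] sum_distrib_left using a2 by simp
  also have "(\<Sum>i\<in>B. \<Sum>j\<in>B. a i j * (u j * u j)) = (\<Sum>j\<in>B. \<Sum>i\<in>B. a j i * (u j * u j))"
    by (subst sum.swap) (simp add: asym)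
  also have "\<dots> = 2 * (\<Sum>i\<in>B. u i * u i)"
    unfolding sum_distrib_right[symmetric] sum_distrib_left using a2 by simp
  finally have "(\<Sum>i\<in>B. \<Sum>j\<in>B. a i j * (u i - u j)\<^sup>2) = 0" using uu uau by simp
  then have zero: "a i j * (u i - u j)\<^sup>2 = 0" if "i \<in> B" "j \<in> B" for i j
    using that fin by (simp add: sum_nonneg_eq_0_iff sum_nonneg a_def)
  have "(\<Sum>j\<in>B. a i j * u j) = 2 * u i" if "i \<in> B" for i
  proof -
    have "(\<Sum>j\<in>B. a i j * u j) = (\<Sum>j\<in>B. a i j * u i)"
    proof (rule sum.cong[OF refl])
      fix j assume "j \<in> B"
      then show "a i j * u j = a i j * u i" using zero[OF that] by fastforce
    qed
    then show ?thesis using a2[OF that] by (simp add: sum_distrib_right[symmetric])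
  qed
  then have du: "(\<Sum>l\<in>B'. d l * r i l) = (\<Sum>l\<in>B'. 2 * r i l)" if "i \<in> B" for i
    using au that by (simp add: u_def sum_distrib_left)
  \<comment> \<open>By \<open>du\<close>, \<open>r\<close> maps \<open>d\<close> and the constant
    vector 2 to the same vector. The inner product with the image of the \<open>k\<close>-th unit
    vector recovers the \<open>k\<close>-th coordinate.\<close>
  have d2: "d k = 2" if k: "k \<in> B'" for k
  proof -
    have e: "(\<Sum>l\<in>B'. v l * of_bool (l = k)) = v k" for v :: "_ \<Rightarrow> real"
      using k fin by (simp add: of_bool_def if_distrib cong: if_cong)
    have "d k = (\<Sum>i\<in>B. (\<Sum>l\<in>B'. d l * r i l) * (\<Sum>l\<in>B'. of_bool (l = k) * r i l))"
      using orthogonal_on_inner[OF rt, of d "\<lambda>l. of_bool (l = k)"] e by simp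
    also have "\<dots> = (\<Sum>i\<in>B. (\<Sum>l\<in>B'. 2 * r i l) * (\<Sum>l\<in>B'. of_bool (l = k) * r i l))"
      using du by simp
    also have "\<dots> = 2"
      using orthogonal_on_inner[OF rt, of "\<lambda>_. 2" "\<lambda>l. of_bool (l = k)"] e[of "\<lambda>_. 2"] by simp
    finally show ?thesis .
  qed
  have "card (N' k) = 2" if k: "k \<in> B'" for k
    using d2[OF k] sum_subset_of_bool[OF fin(2), of "N' k" "\<lambda>_. 1"] N'(1)[OF k]
    by (simp add: d_def b_def)
  then show ?thesis unfolding two_regular_def using fin(2) N' by blast
qed

text \<open>Rows at \<open>T\<close> and columns at the image of \<open>T\<close> are unit vectors,
  so there the intertwining relation reduces to equality of single Chebyshev entries. Traces agree
  by similarity.\<close>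

lemma two_regular_iso_of_intertwined:
  assumes B: "two_regular N B"
    and N': "\<And>x. x \<in> B' \<Longrightarrow> N' x \<subseteq> B' \<and> x \<notin> N' x"
      "\<And>x y. x \<in> B' \<Longrightarrow> y \<in> B' \<Longrightarrow> y \<in> N' x \<longleftrightarrow> x \<in> N' y"
    and r: "orthogonal_on B B' r"
    and i: "intertwines B B' r (\<lambda>x y. of_bool (y \<in> N x)) (\<lambda>x y. of_bool (y \<in> N' x))"
    and T: "T \<subseteq> B" "\<rho> ` T \<subseteq> B'"
    and row: "\<And>x k. x \<in> T \<Longrightarrow> k \<in> B' \<Longrightarrow> r x k = of_bool (k = \<rho> x)"
    and col: "\<And>x j. x \<in> T \<Longrightarrow> j \<in> B \<Longrightarrow> r j (\<rho> x) = of_bool (j = x)"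
  shows "\<exists>f. bij_betw f B B' \<and> (\<forall>x\<in>T. f x = \<rho> x) \<and>
    (\<forall>x\<in>B. \<forall>y\<in>B. y \<in> N x \<longleftrightarrow> f y \<in> N' (f x))"
proof -
  have fin: "finite B" "finite B'" using r by (simp_all add: orthogonal_on_def)
  have reg': "two_regular N' B'" using two_regular_intertwined[OF B N' r i] .
  have c: "intertwines B B' r (cheb N n) (cheb N' n)" for n
    using B N'(1) by (intro intertwines_cheb fin i) (auto simp: two_regular_def)
  have "cheb N n x y = cheb N' n (\<rho> x) (\<rho> y)" if xy: "x \<in> T" "y \<in> T" for n x y
  proof -
    have mem: "x \<in> B" "y \<in> B" "\<rho> x \<in> B'" "\<rho> y \<in> B'" using xy T by auto
    have "cheb N n x y = (\<Sum>j\<in>B. cheb N n x j * of_bool (j = y))"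
      using mem fin by (simp add: of_bool_def if_distrib cong: if_cong)
    also have "\<dots> = (\<Sum>j\<in>B. cheb N n x j * r j (\<rho> y))" using col xy by simp
    also have "\<dots> = (\<Sum>k\<in>B'. r x k * cheb N' n k (\<rho> y))"
      using c mem unfolding intertwines_def by simp
    also have "\<dots> = (\<Sum>k\<in>B'. of_bool (k = \<rho> x) * cheb N' n k (\<rho> y))" using row xy by simp
    also have "\<dots> = cheb N' n (\<rho> x) (\<rho> y)"
      using mem fin by (simp add: of_bool_def if_distrib if_distribR cong: if_cong)
    finally show ?thesis .
  qed
  then show ?thesis
    using two_regular_iso[OF B reg' T] orthogonal_on_trace[OF r c] by blast
qed

section \<open>Switching locally sparse graphs\<close>

definition simple_on :: "'a set \<Rightarrow> ('a \<Rightarrow> 'a set) \<Rightarrow> bool" where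
  "simple_on I N \<longleftrightarrow> (\<forall>x\<in>I. N x \<subseteq> I \<and> x \<notin> N x) \<and> (\<forall>x\<in>I. \<forall>y\<in>I. y \<in> N x \<longleftrightarrow> x \<in> N y)"

text \<open>The sum of the inner degrees counts each edge twice, so the bound says that
  \<open>X\<close> spans at most \<open>card X\<close> edges.\<close>

definition locally_sparse :: "nat \<Rightarrow> 'a set \<Rightarrow> ('a \<Rightarrow> 'a set) \<Rightarrow> bool" where
  "locally_sparse k I N \<longleftrightarrow>
     (\<forall>X\<subseteq>I. card X \<le> k \<longrightarrow> (\<Sum>x\<in>X. card (N x \<inter> X)) \<le> 2 * card X)"

lemma sum_card_neighbours_swap:
  assumes "simple_on I N" "S \<subseteq> I" "T \<subseteq> I" "finite S" "finite T"
  shows "(\<Sum>x\<in>S. card (N x \<inter> T)) = (\<Sum>x\<in>T. card (N x \<inter> S))"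
proof -
  have c: "card (N x \<inter> A) = (\<Sum>y\<in>A. of_bool (y \<in> N x))" if "finite A" for x A
    using that by (simp add: Int_commute)
  have sym: "y \<in> N x \<longleftrightarrow> x \<in> N y" if "x \<in> S" "y \<in> T" for x y
    using assms(1-3) that unfolding simple_on_def by blast
  have "(\<Sum>x\<in>S. \<Sum>y\<in>T. of_bool (y \<in> N x)) = (\<Sum>y\<in>T. \<Sum>x\<in>S. of_bool (x \<in> N y) :: nat)"
    by (subst sum.swap, intro sum.cong refl) (simp add: sym)
  then show ?thesis unfolding c[OF assms(4)] c[OF assms(5)] .
qed

text \<open>Once \<open>T\<close> is no larger than \<open>S\<close>, sparsity applies to their
  union and bounds its average degree by 2. Every inner degree is at least 2, so all are equal to
  2.\<close>

lemma two_regular_of_sparse: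
  assumes I: "finite I" "simple_on I N" and sp: "locally_sparse (2 * m + 1) I N"
    and ST: "S \<subseteq> I" "T \<subseteq> I" "S \<inter> T = {}" "card S \<le> m"
    and S: "\<And>x. x \<in> S \<Longrightarrow> N x \<subseteq> S \<union> T" "\<And>x. x \<in> S \<Longrightarrow> 2 \<le> card (N x)"
    and T: "\<And>x. x \<in> T \<Longrightarrow> 2 \<le> card (N x \<inter> S)"
  shows "two_regular (\<lambda>x. N x \<inter> (S \<union> T)) (S \<union> T)"
proof -
  have fin: "finite S" "finite T" using ST I(1) finite_subset by blast+
  have "card T \<le> card S"
  proof (rule ccontr)
    assume "\<not> card T \<le> card S"
    then have "card S + 1 \<le> card T" by simp
    then obtain T0 where T0: "T0 \<subseteq> T" "card T0 = card S + 1"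
      by (meson obtain_subset_with_card_n)
    have fT0: "finite T0" using T0(1) fin(2) finite_subset by blast
    have disj: "S \<inter> T0 = {}" using T0 ST by blast
    have card: "card (S \<union> T0) = card S + card T0" using fin fT0 disj by (simp add: card_Un_disjoint)
    have "2 * card T0 = (\<Sum>x\<in>T0. 2)" by simp
    also have "\<dots> \<le> (\<Sum>x\<in>T0. card (N x \<inter> S))" using T T0(1) by (intro sum_mono) auto
    finally have a: "2 * card T0 \<le> (\<Sum>x\<in>T0. card (N x \<inter> S))" .
    have b: "(\<Sum>x\<in>T0. card (N x \<inter> S)) \<le> (\<Sum>x\<in>T0. card (N x \<inter> (S \<union> T0)))"
      using fin fT0 by (intro sum_mono card_mono) auto
    have c: "(\<Sum>x\<in>T0. card (N x \<inter> S)) \<le> (\<Sum>x\<in>S. card (N x \<inter> (S \<union> T0)))"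
    proof -
      have "(\<Sum>x\<in>T0. card (N x \<inter> S)) = (\<Sum>x\<in>S. card (N x \<inter> T0))"
        using sum_card_neighbours_swap[OF I(2), of T0 S] T0(1) ST fin fT0 by auto
      also have "\<dots> \<le> (\<Sum>x\<in>S. card (N x \<inter> (S \<union> T0)))"
        using fin fT0 by (intro sum_mono card_mono) auto
      finally show ?thesis .
    qed
    have "(\<Sum>x\<in>S \<union> T0. card (N x \<inter> (S \<union> T0))) =
        (\<Sum>x\<in>S. card (N x \<inter> (S \<union> T0))) + (\<Sum>x\<in>T0. card (N x \<inter> (S \<union> T0)))"
      using fin(1) fT0 disj by (rule sum.union_disjoint)
    moreover have "(\<Sum>x\<in>S \<union> T0. card (N x \<inter> (S \<union> T0))) \<le> 2 * card (S \<union> T0)"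
    proof -
      have "S \<union> T0 \<subseteq> I" "card (S \<union> T0) \<le> 2 * m + 1" using ST T0 card by auto
      then show ?thesis using sp unfolding locally_sparse_def by blast
    qed
    \<comment> \<open>Each edge between \<open>S\<close> and \<open>T0\<close> enters once from
      either end. With s = card S the inequality reads 4(s + 1) \<le> 2(2s + 1).\<close>
    ultimately have "2 * card T0 + 2 * card T0 \<le> 2 * card (S \<union> T0)"
      using add_mono[OF order.trans[OF a c] order.trans[OF a b]] by simp
    then show False using T0(2) card by simp
  qed
  moreover have "card (S \<union> T) = card S + card T" using fin ST(3) by (rule card_Un_disjoint)
  ultimately have "card (S \<union> T) \<le> 2 * m + 1" using ST(4) by simp
  moreover have "S \<union> T \<subseteq> I" using ST by blast
  ultimately have "(\<Sum>x\<in>S \<union> T. card (N x \<inter> (S \<union> T))) \<le> 2 * card (S \<union> T)"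
    using sp unfolding locally_sparse_def by blast
  then have le: "(\<Sum>x\<in>S \<union> T. card (N x \<inter> (S \<union> T))) \<le> (\<Sum>x\<in>S \<union> T. 2)" by simp
  have ge: "2 \<le> card (N x \<inter> (S \<union> T))" if "x \<in> S \<union> T" for x
  proof (cases "x \<in> S")
    case True
    then have "N x \<inter> (S \<union> T) = N x" using S(1) by blast
    then show ?thesis using S(2) True by simp
  next
    case False
    then have "2 \<le> card (N x \<inter> S)" using that T by blast
    also have "\<dots> \<le> card (N x \<inter> (S \<union> T))" using fin by (intro card_mono) auto
    finally show ?thesis .
  qed
  have "card (N x \<inter> (S \<union> T)) = 2" if "x \<in> S \<union> T" for x
  proof (rule ccontr)
    assume "card (N x \<inter> (S \<union> T)) \<noteq> 2"
    then have "2 < card (N x \<inter> (S \<union> T))" using ge[OF that] by simp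
    then have "(\<Sum>x\<in>S \<union> T. 2) < (\<Sum>x\<in>S \<union> T. card (N x \<inter> (S \<union> T)))"
      using ge that fin by (intro sum_strict_mono_ex1) auto
    then show False using le by simp
  qed
  then show ?thesis
    using I(2) ST fin unfolding two_regular_def simple_on_def by blast
qed

text \<open>Both graphs live on one index set, the positions in the two vertex orderings.
  \<open>size\<close> counts rows that are not unit vectors, since the switching block may itself
  contain unit rows.\<close>

locale sparse_switching =
  fixes I :: "'a set" and N N' :: "'a \<Rightarrow> 'a set" and r :: "'a \<Rightarrow> 'a \<Rightarrow> real" and m :: nat
  assumes simple: "simple_on I N" "simple_on I N'"
    and orth: "orthogonal_on I I r"
    and inter: "intertwines I I r (\<lambda>x y. of_bool (y \<in> N x)) (\<lambda>x y. of_bool (y \<in> N' x))"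
    and min_degree: "\<And>x. x \<in> I \<Longrightarrow> 2 \<le> card (N x)"
    and sparse: "locally_sparse (2 * m + 1) I N"
    and size: "card {i \<in> I. \<not> (\<exists>k\<in>I. \<forall>l\<in>I. r i l = of_bool (l = k))} \<le> m"
begin

text \<open>The vertices in \<open>U\<close> are merely renamed, by \<open>\<rho>\<close>; \<open>S\<close> is the set that is really switched and
  \<open>T\<close> is its outer neighbourhood.\<close>

definition U where "U = {i \<in> I. \<exists>k\<in>I. \<forall>l\<in>I. r i l = of_bool (l = k)}"
definition \<rho> where "\<rho> i = (SOME k. k \<in> I \<and> (\<forall>l\<in>I. r i l = of_bool (l = k)))"
definition S where "S = I - U"
definition S' where "S' = I - \<rho> ` U"
definition T where "T = {x \<in> U. N x \<inter> S \<noteq> {}}"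

lemma fin: "finite I" using orth by (simp add: orthogonal_on_def)

lemma sub: "U \<subseteq> I" "S \<subseteq> I" "S' \<subseteq> I" "T \<subseteq> U" "T \<subseteq> I" "S \<inter> U = {}"
proof -
  show "U \<subseteq> I" unfolding U_def by (rule Collect_restrict)
  moreover show "T \<subseteq> U" unfolding T_def by (rule Collect_restrict)
  ultimately show "T \<subseteq> I" by (rule order.trans[rotated])
  show "S \<subseteq> I" "S' \<subseteq> I" "S \<inter> U = {}" unfolding S_def S'_def by blast+
qed

lemma \<rho>: "i \<in> U \<Longrightarrow> \<rho> i \<in> I" and row: "i \<in> U \<Longrightarrow> l \<in> I \<Longrightarrow> r i l = of_bool (l = \<rho> i)"
proof -
  assume "i \<in> U"
  then have "\<exists>k. k \<in> I \<and> (\<forall>l\<in>I. r i l = of_bool (l = k))" by (auto simp: U_def)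
  from someI_ex[OF this, folded \<rho>_def]
  show "\<rho> i \<in> I" "l \<in> I \<Longrightarrow> r i l = of_bool (l = \<rho> i)" by blast+
qed

lemma sum_single:
  fixes f :: "'a \<Rightarrow> real"
  assumes "k \<in> I" shows "(\<Sum>l\<in>I. f l * of_bool (l = k)) = f k"
proof -
  have "(\<Sum>l\<in>I. f l * of_bool (l = k)) = (\<Sum>l\<in>I. if l = k then f l else 0)"
    by (rule sum.cong) auto
  then show ?thesis using assms fin by simp
qed

text \<open>The inner product of any row with the unit row of \<open>i\<close> is its entry in
  column \<open>\<rho> i\<close>, and distinct rows are orthogonal.\<close>

lemma col: assumes "i \<in> U" "j \<in> I" shows "r j (\<rho> i) = of_bool (j = i)"
proof -
  have "r j (\<rho> i) = (\<Sum>l\<in>I. r j l * of_bool (l = \<rho> i))" using sum_single[OF \<rho>[OF assms(1)]] by simp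
  also have "\<dots> = (\<Sum>l\<in>I. r j l * r i l)" using row[OF assms(1)] by simp
  also have "\<dots> = of_bool (j = i)" using orth assms sub(1) by (auto simp: orthogonal_on_def)
  finally show ?thesis .
qed

lemma \<rho>_inj: "inj_on \<rho> U"
proof
  fix x y assume "x \<in> U" "y \<in> U" "\<rho> x = \<rho> y"
  moreover from \<open>x \<in> U\<close> have "x \<in> I" using sub(1) by blast
  ultimately have "(of_bool (x = y) :: real) = of_bool (x = x)"
    using col[of x x] col[of y x] by simp
  then show "x = y" by (simp split: if_splits)
qed

lemma switched_row:
  assumes "x \<in> U" "k \<in> I"
  shows "of_bool (k \<in> N' (\<rho> x)) = (\<Sum>j\<in>I. of_bool (j \<in> N x) * r j k)"
proof -
  have "(\<Sum>j\<in>I. r x j * of_bool (k \<in> N' j)) = (\<Sum>j\<in>I. of_bool (k \<in> N' j) * of_bool (j = \<rho> x))"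
    using row[OF assms(1)] by (simp add: mult.commute)
  also have "\<dots> = (of_bool (k \<in> N' (\<rho> x)) :: real)"
    using sum_single[OF \<rho>[OF assms(1)], of "\<lambda>j. of_bool (k \<in> N' j)"] by simp
  finally show ?thesis using inter assms sub(1) by (auto simp: intertwines_def)
qed

lemma adj_U:
  assumes "x \<in> U" "y \<in> U"
  shows "y \<in> N x \<longleftrightarrow> \<rho> y \<in> N' (\<rho> x)"
proof -
  have "(of_bool (\<rho> y \<in> N' (\<rho> x)) :: real) = (\<Sum>j\<in>I. of_bool (j \<in> N x) * of_bool (j = y))"
    using switched_row[OF assms(1) \<rho>[OF assms(2)]] col[OF assms(2)] by simp
  also have "\<dots> = of_bool (y \<in> N x)"
    using sum_single[of y "\<lambda>j. of_bool (j \<in> N x)"] assms sub(1) by auto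
  finally show ?thesis by auto
qed

lemma switched_row_S:
  assumes "x \<in> U" "k \<in> S'"
  shows "of_bool (k \<in> N' (\<rho> x)) = (\<Sum>j\<in>N x \<inter> S. r j k)"
proof -
  have k: "k \<in> I" using assms sub by auto
  have "r j k = 0" if "j \<in> U" for j using row[OF that k] that assms(2) by (auto simp: S'_def)
  then have e: "of_bool (j \<in> N x) * r j k = of_bool (j \<in> N x \<inter> S) * r j k" if "j \<in> I" for j
    using that by (auto simp: S_def)
  have "of_bool (k \<in> N' (\<rho> x)) = (\<Sum>j\<in>I. of_bool (j \<in> N x) * r j k)"
    using switched_row[OF assms(1) k] .
  also have "\<dots> = (\<Sum>j\<in>I. of_bool (j \<in> N x \<inter> S) * r j k)"
    using e by (rule sum.cong[OF refl])
  also have "\<dots> = (\<Sum>j\<in>N x \<inter> S. r j k)" using fin sub by (intro sum_subset_of_bool) auto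
  finally show ?thesis .
qed

text \<open>For a single neighbour \<open>j\<close> the sum has one term, so on \<open>S'\<close>
  the row of \<open>j\<close> is the 0/1 adjacency row of \<open>\<rho> x\<close>; elsewhere it
  vanishes. A 0/1 row of norm 1 has exactly one entry 1.\<close>

lemma not_single_neighbour:
  assumes "x \<in> U"
  shows "card (N x \<inter> S) \<noteq> 1"
proof
  assume "card (N x \<inter> S) = 1"
  then obtain j where j: "N x \<inter> S = {j}" by (meson card_1_singletonE)
  then have jS: "j \<in> S" "j \<in> I" using sub by auto
  define K where "K = N' (\<rho> x) \<inter> S'"
  have rj: "r j k = of_bool (k \<in> K)" if "k \<in> I" for k
  proof (cases "k \<in> S'")
    case True
    then show ?thesis using switched_row_S[OF assms True] j by (simp add: K_def)
  next
    case False
    then obtain u where "u \<in> U" "k = \<rho> u" using \<open>k \<in> I\<close> by (auto simp: S'_def)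
    then show ?thesis using col jS sub False by (auto simp: K_def)
  qed
  have K: "K \<subseteq> I" using sub by (auto simp: K_def)
  have "1 = (\<Sum>k\<in>I. r j k * r j k)" using orth jS by (simp add: orthogonal_on_def)
  also have "\<dots> = (\<Sum>k\<in>I. of_bool (k \<in> K) * 1)" using rj by (intro sum.cong) auto
  also have "\<dots> = real (card K)" using sum_subset_of_bool[OF fin K, of "\<lambda>_. 1"] by simp
  finally have "card K = 1" by simp
  then obtain k where "K = {k}" by (meson card_1_singletonE)
  then have "j \<in> U" using rj jS K by (auto simp: U_def)
  then show False using jS by (simp add: S_def)
qed

lemma two_regular_switched: "two_regular (\<lambda>x. N x \<inter> (S \<union> T)) (S \<union> T)"
proof (rule two_regular_of_sparse[OF fin simple(1) sparse sub(2,5)])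
  show "S \<inter> T = {}" using sub by auto
  have "S = {i \<in> I. \<not> (\<exists>k\<in>I. \<forall>l\<in>I. r i l = of_bool (l = k))}" by (auto simp: S_def U_def)
  then show "card S \<le> m" using size by simp
  show "2 \<le> card (N x)" if "x \<in> S" for x using that min_degree sub by blast
  show "N x \<subseteq> S \<union> T" if "x \<in> S" for x
  proof
    fix y assume y: "y \<in> N x"
    then have "y \<in> I" "x \<in> N y" using simple(1) that sub unfolding simple_on_def by blast+
    then show "y \<in> S \<union> T" using that by (auto simp: S_def T_def)
  qed
  show "2 \<le> card (N x \<inter> S)" if "x \<in> T" for x
  proof -
    have "finite (N x \<inter> S)" using fin sub finite_subset by blast
    then have "card (N x \<inter> S) \<noteq> 0" using that by (simp add: T_def)
    moreover have "card (N x \<inter> S) \<noteq> 1" using not_single_neighbour that sub by blast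
    ultimately show ?thesis by simp
  qed
qed

lemma sum_restrict:
  fixes f :: "'a \<Rightarrow> real"
  assumes "A \<subseteq> I" "\<And>x. x \<in> I - A \<Longrightarrow> f x = 0"
  shows "sum f A = sum f I"
proof (rule sum.mono_neutral_left[OF fin assms(1)])
  show "\<forall>x\<in>I - A. f x = 0" using assms(2) by blast
qed

text \<open>Together with \<open>zero_col\<close> this makes \<open>r\<close> block diagonal for
  \<open>S \<union> T\<close> against the remainder, so both orthogonality and intertwining restrict
  to the block.\<close>

lemma zero_row: "i \<in> I \<Longrightarrow> i \<notin> S \<union> T \<Longrightarrow> k \<in> S' \<union> \<rho> ` T \<Longrightarrow> r i k = 0"
proof -
  assume i: "i \<in> I" "i \<notin> S \<union> T" and k: "k \<in> S' \<union> \<rho> ` T"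
  have iU: "i \<in> U" using i by (auto simp: S_def)
  have "k \<noteq> \<rho> i" using k i iU \<rho>_inj sub(4) by (auto simp: S'_def dest: inj_onD)
  moreover have "k \<in> I" using k sub \<rho> by auto
  ultimately show "r i k = 0" using row[OF iU] by simp
qed

lemma zero_col: "i \<in> S \<union> T \<Longrightarrow> k \<in> I \<Longrightarrow> k \<notin> S' \<union> \<rho> ` T \<Longrightarrow> r i k = 0"
proof -
  assume i: "i \<in> S \<union> T" and k: "k \<in> I" "k \<notin> S' \<union> \<rho> ` T"
  then obtain u where u: "u \<in> U" "u \<notin> T" "k = \<rho> u" by (auto simp: S'_def)
  moreover have "i \<in> I" "i \<noteq> u" using i u sub by auto
  ultimately show "r i k = 0" using col by simp
qed

lemma orthogonal_switched: "orthogonal_on (S \<union> T) (S' \<union> \<rho> ` T) r"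
proof -
  have s: "S \<union> T \<subseteq> I" "S' \<union> \<rho> ` T \<subseteq> I" using sub \<rho> by auto
  have "(\<Sum>k\<in>S' \<union> \<rho> ` T. r i k * r j k) = of_bool (i = j)" if "i \<in> S \<union> T" "j \<in> S \<union> T" for i j
  proof -
    have "(\<Sum>k\<in>S' \<union> \<rho> ` T. r i k * r j k) = (\<Sum>k\<in>I. r i k * r j k)"
      using s zero_col that by (intro sum_restrict) auto
    moreover have "i \<in> I" "j \<in> I" using that s by blast+
    ultimately show ?thesis using orth by (simp add: orthogonal_on_def)
  qed
  moreover have "(\<Sum>i\<in>S \<union> T. r i k * r i l) = of_bool (k = l)"
    if "k \<in> S' \<union> \<rho> ` T" "l \<in> S' \<union> \<rho> ` T" for k l
  proof -
    have "(\<Sum>i\<in>S \<union> T. r i k * r i l) = (\<Sum>i\<in>I. r i k * r i l)"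
      using s zero_row that by (intro sum_restrict) auto
    moreover have "k \<in> I" "l \<in> I" using that s by blast+
    ultimately show ?thesis using orth by (simp add: orthogonal_on_def)
  qed
  ultimately show ?thesis using s fin finite_subset unfolding orthogonal_on_def by blast
qed

lemma intertwines_switched:
  "intertwines (S \<union> T) (S' \<union> \<rho> ` T) r
     (\<lambda>x y. of_bool (y \<in> N x \<inter> (S \<union> T))) (\<lambda>x y. of_bool (y \<in> N' x \<inter> (S' \<union> \<rho> ` T)))"
proof -
  have s: "S \<union> T \<subseteq> I" "S' \<union> \<rho> ` T \<subseteq> I" using sub \<rho> by auto
  have "(\<Sum>j\<in>S' \<union> \<rho> ` T. r i j * of_bool (k \<in> N' j \<inter> (S' \<union> \<rho> ` T))) =
      (\<Sum>j\<in>S \<union> T. of_bool (j \<in> N i \<inter> (S \<union> T)) * r j k)"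
    if i: "i \<in> S \<union> T" and k: "k \<in> S' \<union> \<rho> ` T" for i k
  proof -
    have "(\<Sum>j\<in>S' \<union> \<rho> ` T. r i j * of_bool (k \<in> N' j \<inter> (S' \<union> \<rho> ` T))) =
        (\<Sum>j\<in>S' \<union> \<rho> ` T. r i j * of_bool (k \<in> N' j))"
      using k by simp
    also have "\<dots> = (\<Sum>j\<in>I. r i j * of_bool (k \<in> N' j))"
      using s zero_col i by (intro sum_restrict) auto
    also have "\<dots> = (\<Sum>j\<in>I. of_bool (j \<in> N i) * r j k)"
      using inter i k s unfolding intertwines_def by blast
    also have "\<dots> = (\<Sum>j\<in>S \<union> T. of_bool (j \<in> N i) * r j k)"
      using s zero_row k by (intro sum_restrict[symmetric]) auto
    also have "\<dots> = (\<Sum>j\<in>S \<union> T. of_bool (j \<in> N i \<inter> (S \<union> T)) * r j k)"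
      by (intro sum.cong) auto
    finally show ?thesis .
  qed
  then show ?thesis by (simp add: intertwines_def)
qed

text \<open>The isomorphism of the switched block and the renaming of \<open>U\<close> overlap
  exactly in \<open>T\<close>, where they agree. Any pair of vertices lies in one of the two domains
  or joins \<open>S\<close> to \<open>U - T\<close>.\<close>

lemma isomorphic:
  "\<exists>f. bij_betw f I I \<and> (\<forall>x\<in>I. \<forall>y\<in>I. y \<in> N x \<longleftrightarrow> f y \<in> N' (f x))"
proof -
  have s: "S \<union> T \<subseteq> I" "S' \<union> \<rho> ` T \<subseteq> I" using sub \<rho> by auto
  let ?B = "S \<union> T" and ?B' = "S' \<union> \<rho> ` T"
  have "\<exists>f. bij_betw f ?B ?B' \<and> (\<forall>x\<in>T. f x = \<rho> x) \<and>
    (\<forall>x\<in>?B. \<forall>y\<in>?B. y \<in> N x \<inter> ?B \<longleftrightarrow> f y \<in> N' (f x) \<inter> ?B')"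
  proof (rule two_regular_iso_of_intertwined[OF two_regular_switched _ _ orthogonal_switched intertwines_switched])
    show "N' x \<inter> ?B' \<subseteq> ?B' \<and> x \<notin> N' x \<inter> ?B'" if "x \<in> ?B'" for x
      using simple(2) s that unfolding simple_on_def by blast
    show "y \<in> N' x \<inter> ?B' \<longleftrightarrow> x \<in> N' y \<inter> ?B'" if "x \<in> ?B'" "y \<in> ?B'" for x y
      using simple(2) s that unfolding simple_on_def by blast
    show "r x k = of_bool (k = \<rho> x)" if "x \<in> T" "k \<in> ?B'" for x k
      using row[of x k] that s sub(4) by blast
    show "r j (\<rho> x) = of_bool (j = x)" if "x \<in> T" "j \<in> ?B" for x j
      using col[of x j] that s sub(4) by blast
  qed auto
  then obtain f where f: "bij_betw f ?B ?B'" "\<And>x. x \<in> T \<Longrightarrow> f x = \<rho> x"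
    and adj: "\<And>x y. x \<in> ?B \<Longrightarrow> y \<in> ?B \<Longrightarrow> y \<in> N x \<inter> ?B \<longleftrightarrow> f y \<in> N' (f x) \<inter> ?B'" by blast
  define h where "h = (\<lambda>x. if x \<in> S then f x else \<rho> x)"
  have hB: "h x = f x" if "x \<in> ?B" for x using that f(2) by (auto simp: h_def)
  have hU: "h x = \<rho> x" if "x \<in> U" for x using that sub(6) by (auto simp: h_def)
  have fS: "f x \<in> S'" if "x \<in> S" for x
  proof -
    have "f x \<in> ?B'" using f(1) that by (auto simp: bij_betw_def)
    moreover have "f x \<noteq> f t" if "t \<in> T" for t
      using f(1) that \<open>x \<in> S\<close> sub unfolding bij_betw_def inj_on_def by blast
    ultimately show ?thesis using f(2) by auto
  qed
  have "bij_betw h ?B ?B'" using f(1) bij_betw_cong[of ?B h f] hB by simp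
  moreover have "bij_betw h (U - T) (\<rho> ` (U - T))"
    using hU \<rho>_inj by (auto simp: bij_betw_def inj_on_def)
  moreover have "?B' \<inter> \<rho> ` (U - T) = {}"
    using \<rho>_inj sub(4) by (auto simp: S'_def inj_on_def)
  ultimately have "bij_betw h (?B \<union> (U - T)) (?B' \<union> \<rho> ` (U - T))" by (rule bij_betw_combine)
  moreover have "?B \<union> (U - T) = I" using sub by (auto simp: S_def)
  moreover have "?B' \<union> \<rho> ` (U - T) = I" using sub \<rho> by (auto simp: S'_def)
  ultimately have bij: "bij_betw h I I" by simp
  \<comment> \<open>There are no such edges in the first graph by the choice of \<open>T\<close>,
    nor in the second, where the sum of \<open>switched_row_S\<close> is empty.\<close>
  have far: "y \<notin> N x \<and> h y \<notin> N' (h x)" "x \<notin> N y \<and> h x \<notin> N' (h y)" if "x \<in> S" "y \<in> U - T" for x y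
  proof -
    have "x \<in> I" "y \<in> I" using that sub by blast+
    then have I: "x \<in> I" "y \<in> I" "h x \<in> I" "h y \<in> I" using bij_betwE[OF bij] by blast+
    have "N y \<inter> S = {}" using that by (auto simp: T_def)
    then have 1: "x \<notin> N y" using that by auto
    have "h x \<in> S'" using fS hB that by simp
    then have 2: "h x \<notin> N' (h y)"
      using switched_row_S[of y "h x"] that \<open>N y \<inter> S = {}\<close> hU by (simp split: if_splits)
    show "x \<notin> N y \<and> h x \<notin> N' (h y)" using 1 2 by simp
    show "y \<notin> N x \<and> h y \<notin> N' (h x)" using 1 2 I simple unfolding simple_on_def by blast
  qed
  have "y \<in> N x \<longleftrightarrow> h y \<in> N' (h x)" if xy: "x \<in> I" "y \<in> I" for x y
  proof -
    consider "x \<in> ?B" "y \<in> ?B" | "x \<in> U" "y \<in> U" | "x \<in> S" "y \<in> U - T" | "y \<in> S" "x \<in> U - T"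
      using xy unfolding S_def by blast
    then show ?thesis
    proof cases
      case 1
      then have "f y \<in> ?B'" using f(1) by (auto simp: bij_betw_def)
      then show ?thesis using adj[OF 1] 1 hB by simp
    next
      case 2
      then show ?thesis using adj_U hU by simp
    next
      case 3
      then show ?thesis using far by blast
    next
      case 4
      then show ?thesis using far by blast
    qed
  qed
  then show ?thesis using bij by blast
qed

end

section \<open>The 2-core\<close>

lemma core2_subset: "core2 V E \<subseteq> V"
proof -
  have "(peel E ^^ k) V \<subseteq> V" for k
    by (induction k) (auto simp: peel_def)
  then show ?thesis by (simp add: core2_def)
qed

text \<open>A round that changes the set removes at least one vertex, so after \<open>card V\<close>
  rounds the set is stationary, and stationarity is the degree condition.\<close>

lemma core2_min_degree:
  assumes "finite V" "v \<in> core2 V E"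
  shows "2 \<le> card {u \<in> core2 V E. u \<noteq> v \<and> {u, v} \<in> E}"
proof -
  define P where "P = (\<lambda>k. (peel E ^^ k) V)"
  have step: "P (Suc k) \<subseteq> P k" "P k \<subseteq> V" for k
  proof -
    show "P (Suc k) \<subseteq> P k" for k by (auto simp: P_def peel_def)
    then show "P k \<subseteq> V" by (induction k) (auto simp: P_def)
  qed
  have "peel E (P k) = P k \<or> card (P k) + k \<le> card V" for k
  proof (induction k)
    case 0
    then show ?case by (simp add: P_def)
  next
    case (Suc k)
    have pS: "peel E (P k) = P (Suc k)" by (simp add: P_def)
    show ?case
    proof (cases "P (Suc k) = P k")
      case True
      then show ?thesis using pS by metis
    next
      case False
      then have "card (P (Suc k)) < card (P k)"
        using step[of k] assms(1) by (metis finite_subset psubsetI psubset_card_mono)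
      then show ?thesis using Suc.IH False pS by auto
    qed
  qed
  from this[of "card V"] have "peel E (P (card V)) = P (card V)"
  proof
    \<comment> \<open>Here every vertex has been peeled off, and the empty set is
      stationary.\<close>
    assume "card (P (card V)) + card V \<le> card V"
    moreover have "finite (P (card V))" using step(2) assms(1) finite_subset by blast
    ultimately have "P (card V) = {}" by simp
    then show ?thesis by (simp add: peel_def)
  qed
  then have "peel E (core2 V E) = core2 V E" by (simp add: core2_def P_def)
  then show ?thesis using assms(2) unfolding peel_def by blast
qed

section \<open>From matrices and index sets back to graphs\<close>

text \<open>Increasing index pairs embed into the edges because \<open>\<sigma>\<close> is
  injective; the factor 2 accounts for the swapped pairs.\<close>

lemma ordered_pairs_le_edges:
  fixes N :: "nat \<Rightarrow> nat set"
  assumes X: "finite X" "inj_on \<sigma> X" and E: "finite E"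
    and N: "\<And>i j. i \<in> X \<Longrightarrow> j \<in> X \<Longrightarrow> j \<in> N i \<longleftrightarrow> j \<noteq> i \<and> {\<sigma> i, \<sigma> j} \<in> E"
  shows "(\<Sum>i\<in>X. card (N i \<inter> X)) \<le> 2 * card {e \<in> E. e \<subseteq> \<sigma> ` X}"
proof -
  define P where "P = {(i, j). i \<in> X \<and> j \<in> X \<and> i < j \<and> {\<sigma> i, \<sigma> j} \<in> E}"
  have fP: "finite P" by (rule finite_subset[of _ "X \<times> X"]) (use X in \<open>auto simp: P_def\<close>)
  have "(SIGMA i:X. N i \<inter> X) \<subseteq> P \<union> prod.swap ` P"
  proof
    fix z assume "z \<in> (SIGMA i:X. N i \<inter> X)"
    then obtain i j where z: "z = (i, j)" "i \<in> X" "j \<in> X" "j \<in> N i" by blast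
    then have e: "j \<noteq> i" "{\<sigma> i, \<sigma> j} \<in> E" "{\<sigma> j, \<sigma> i} \<in> E"
      using N[of i j] by (auto simp: insert_commute)
    show "z \<in> P \<union> prod.swap ` P"
    proof (cases "i < j")
      case True
      then show ?thesis using z e by (auto simp: P_def)
    next
      case False
      then have "(j, i) \<in> P" using z e by (auto simp: P_def)
      then show ?thesis using z by (auto intro: image_eqI[of _ _ "(j, i)"])
    qed
  qed
  then have "card (SIGMA i:X. N i \<inter> X) \<le> card (P \<union> prod.swap ` P)"
    using fP by (intro card_mono) auto
  also have "\<dots> \<le> card P + card (prod.swap ` P)" by (rule card_Un_le)
  also have "\<dots> \<le> 2 * card P" using card_image_le[OF fP, of prod.swap] by simp
  also have "card P \<le> card {e \<in> E. e \<subseteq> \<sigma> ` X}"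
  proof (rule card_inj_on_le)
    show "inj_on (\<lambda>(i, j). {\<sigma> i, \<sigma> j}) P"
    proof (rule inj_onI, clarify)
      fix i j k l
      assume "(i, j) \<in> P" "(k, l) \<in> P" and e: "{\<sigma> i, \<sigma> j} = {\<sigma> k, \<sigma> l}"
      then have m: "i \<in> X" "j \<in> X" "k \<in> X" "l \<in> X" "i < j" "k < l" by (auto simp: P_def)
      from e have "\<sigma> i = \<sigma> k \<and> \<sigma> j = \<sigma> l \<or> \<sigma> i = \<sigma> l \<and> \<sigma> j = \<sigma> k"
        by (simp add: doubleton_eq_iff)
      then have "i = k \<and> j = l \<or> i = l \<and> j = k" using inj_onD[OF X(2)] m by metis
      then show "i = k \<and> j = l" using m by linarith
    qed
    show "(\<lambda>(i, j). {\<sigma> i, \<sigma> j}) ` P \<subseteq> {e \<in> E. e \<subseteq> \<sigma> ` X}" by (auto simp: P_def)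
  qed (use E in simp)
  finally show ?thesis using X by simp
qed

lemma four_block_orthogonal:
  assumes Q: "orthogonal_mat m Q" and "m \<le> n"
    and R: "R = four_block_mat Q (0\<^sub>m m (n - m)) (0\<^sub>m (n - m) m) (1\<^sub>m (n - m))"
  shows "R \<in> carrier_mat n n" "transpose_mat R * R = 1\<^sub>m n" "R * transpose_mat R = 1\<^sub>m n"
proof -
  have Qc: "Q \<in> carrier_mat m m" "transpose_mat Q * Q = 1\<^sub>m m" using Q by (simp_all add: orthogonal_mat_def)
  have n: "m + (n - m) = n" using assms(2) by simp
  show c: "R \<in> carrier_mat n n"
    unfolding R using four_block_carrier_mat[OF Qc(1), of "1\<^sub>m (n - m)" "n - m" "n - m"] n by simp
  have "transpose_mat R = four_block_mat (transpose_mat Q) (0\<^sub>m m (n - m)) (0\<^sub>m (n - m) m) (1\<^sub>m (n - m))"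
    unfolding R using Qc(1) by (subst transpose_four_block_mat) auto
  then have "transpose_mat R * R = four_block_mat (1\<^sub>m m) (0\<^sub>m m (n - m)) (0\<^sub>m (n - m) m) (1\<^sub>m (n - m))"
    unfolding R using Qc by (simp, subst mult_four_block_mat[of _ m m _ "n - m" _ "n - m"]) auto
  also have "\<dots> = 1\<^sub>m n" using n by simp
  finally show t: "transpose_mat R * R = 1\<^sub>m n" .
  show "R * transpose_mat R = 1\<^sub>m n"
    by (rule mat_mult_left_right_inverse[OF _ c t]) (use c in simp)
qed

lemma graph_iso_of_switching:
  assumes V: "simple_graph V E" and W: "simple_graph W F" and sw: "switching_le m V E W F"
    and deg: "\<And>v. v \<in> V \<Longrightarrow> 2 \<le> card {u \<in> V. u \<noteq> v \<and> {u, v} \<in> E}"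
    and sparse: "\<And>X. X \<subseteq> V \<Longrightarrow> card X \<le> 2 * m + 1 \<Longrightarrow> card {e \<in> E. e \<subseteq> X} \<le> card X"
  shows "graph_iso V E W F"
proof -
  define n where "n = card V"
  define I where "I = {0..<n}"
  obtain \<sigma> \<tau> Q R where \<sigma>: "bij_betw \<sigma> I V" and \<tau>: "bij_betw \<tau> I W" and Q: "orthogonal_mat m Q"
    and R: "R = four_block_mat Q (0\<^sub>m m (n - m)) (0\<^sub>m (n - m) m) (1\<^sub>m (n - m))"
    and H: "Defs.adj_mat n \<tau> F = transpose_mat R * Defs.adj_mat n \<sigma> E * R" and mn: "m \<le> n"
    using sw unfolding switching_le_def Let_def n_def I_def by blast
  note R' = four_block_orthogonal[OF Q mn R]
  have finE: "finite E"
  proof (rule finite_subset)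
    show "E \<subseteq> Pow V" using V by (auto simp: simple_graph_def)
    show "finite (Pow V)" using V by (simp add: simple_graph_def)
  qed
  define N where "N = (\<lambda>i. {j \<in> I. j \<noteq> i \<and> {\<sigma> i, \<sigma> j} \<in> E})"
  define N' where "N' = (\<lambda>i. {j \<in> I. j \<noteq> i \<and> {\<tau> i, \<tau> j} \<in> F})"
  define r where "r = (\<lambda>i j. R $$ (i, j))"
  have A: "Defs.adj_mat n \<sigma> E \<in> carrier_mat n n" "Defs.adj_mat n \<tau> F \<in> carrier_mat n n"
    by (simp_all add: Defs.adj_mat_def)
  have Aij: "Defs.adj_mat n \<sigma> E $$ (i, j) = of_bool (j \<in> N i)" "Defs.adj_mat n \<tau> F $$ (i, j) = of_bool (j \<in> N' i)"
    if "i \<in> I" "j \<in> I" for i j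
    using that by (auto simp: Defs.adj_mat_def N_def N'_def I_def)
  have prod: "(X * Y) $$ (i, k) = (\<Sum>j\<in>I. X $$ (i, j) * Y $$ (j, k))"
    if "X \<in> carrier_mat n n" "Y \<in> carrier_mat n n" "i \<in> I" "k \<in> I" for X Y :: "real mat" and i k
    using that by (simp add: scalar_prod_def I_def)
  have RT: "transpose_mat R \<in> carrier_mat n n" using R'(1) by simp
  have RTij: "transpose_mat R $$ (i, j) = r j i" if "i \<in> I" "j \<in> I" for i j
    using that R'(1) by (simp add: r_def I_def)
  interpret sparse_switching I N N' r m
  proof
    show "simple_on I N" "simple_on I N'"
      by (auto simp: simple_on_def N_def N'_def insert_commute)
    have "(\<Sum>k\<in>I. r i k * r j k) = of_bool (i = j)" if "i \<in> I" "j \<in> I" for i j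
    proof -
      have "(\<Sum>k\<in>I. r i k * r j k) = (R * transpose_mat R) $$ (i, j)"
        using prod[OF R'(1) RT that] RTij that by (simp add: r_def)
      then show ?thesis using R'(3) that by (simp add: I_def)
    qed
    moreover have "(\<Sum>i\<in>I. r i k * r i l) = of_bool (k = l)" if "k \<in> I" "l \<in> I" for k l
    proof -
      have "(\<Sum>i\<in>I. r i k * r i l) = (transpose_mat R * R) $$ (k, l)"
        using prod[OF RT R'(1) that] RTij that by (simp add: r_def)
      then show ?thesis using R'(2) that by (simp add: I_def)
    qed
    ultimately show "orthogonal_on I I r" by (simp add: orthogonal_on_def I_def)
    \<comment> \<open>Multiplying the switching equation by \<open>R\<close> from the left cancels
      the transpose and leaves the intertwining form.\<close>
    have RH: "R * Defs.adj_mat n \<tau> F = Defs.adj_mat n \<sigma> E * R"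
    proof -
      have "R * Defs.adj_mat n \<tau> F = R * (transpose_mat R * (Defs.adj_mat n \<sigma> E * R))"
        unfolding H using assoc_mult_mat[OF RT A(1) R'(1)] by simp
      also have "\<dots> = (R * transpose_mat R) * (Defs.adj_mat n \<sigma> E * R)"
        using assoc_mult_mat[OF R'(1) RT, of "Defs.adj_mat n \<sigma> E * R" n] A(1) R'(1) by simp
      also have "\<dots> = Defs.adj_mat n \<sigma> E * R" using R'(1,3) A(1) by simp
      finally show ?thesis .
    qed
    have "(\<Sum>j\<in>I. r i j * of_bool (k \<in> N' j)) = (\<Sum>j\<in>I. of_bool (j \<in> N i) * r j k)"
      if "i \<in> I" "k \<in> I" for i k
      using arg_cong[OF RH, of "\<lambda>M. M $$ (i, k)"] prod[OF R'(1) A(2) that] prod[OF A(1) R'(1) that]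
        Aij that by (simp add: r_def)
    then show "intertwines I I r (\<lambda>x y. of_bool (y \<in> N x)) (\<lambda>x y. of_bool (y \<in> N' x))"
      by (simp add: intertwines_def)
    show "2 \<le> card (N i)" if "i \<in> I" for i
    proof -
      have "\<sigma> ` N i = {u \<in> V. u \<noteq> \<sigma> i \<and> {u, \<sigma> i} \<in> E}"
        using \<sigma> that by (auto simp: N_def bij_betw_def inj_on_def insert_commute)
      moreover have "inj_on \<sigma> (N i)"
        using \<sigma> by (rule inj_on_subset[OF bij_betw_imp_inj_on]) (auto simp: N_def)
      ultimately have "card (N i) = card {u \<in> V. u \<noteq> \<sigma> i \<and> {u, \<sigma> i} \<in> E}"
        by (metis card_image)
      then show ?thesis using deg[of "\<sigma> i"] \<sigma> that by (auto simp: bij_betw_def)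
    qed
    show "locally_sparse (2 * m + 1) I N"
      unfolding locally_sparse_def
    proof (intro allI impI)
      fix X assume X: "X \<subseteq> I" "card X \<le> 2 * m + 1"
      have inj: "inj_on \<sigma> X" using \<sigma> X(1) inj_on_subset by (auto simp: bij_betw_def)
      have "(\<Sum>i\<in>X. card (N i \<inter> X)) \<le> 2 * card {e \<in> E. e \<subseteq> \<sigma> ` X}"
      proof (rule ordered_pairs_le_edges[OF _ inj finE])
        show "finite X" using X(1) finite_subset by (auto simp: I_def)
        show "j \<in> N i \<longleftrightarrow> j \<noteq> i \<and> {\<sigma> i, \<sigma> j} \<in> E" if "i \<in> X" "j \<in> X" for i j
          using that X(1) by (auto simp: N_def)
      qed
      also have "card {e \<in> E. e \<subseteq> \<sigma> ` X} \<le> card (\<sigma> ` X)"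
      proof (rule sparse)
        show "\<sigma> ` X \<subseteq> V" using \<sigma> X(1) by (auto simp: bij_betw_def)
        show "card (\<sigma> ` X) \<le> 2 * m + 1" using X(2) card_image[OF inj] by simp
      qed
      finally show "(\<Sum>i\<in>X. card (N i \<inter> X)) \<le> 2 * card X" using card_image[OF inj] by simp
    qed
    \<comment> \<open>Rows from \<open>m\<close> on belong to the identity block, so at most
      \<open>m\<close> rows are not unit vectors.\<close>
    have "r i l = of_bool (l = i)" if "i \<in> I" "m \<le> i" "l \<in> I" for i l
      using that Q mn unfolding r_def R I_def orthogonal_mat_def by auto
    then have "{i \<in> I. \<not> (\<exists>k\<in>I. \<forall>l\<in>I. r i l = of_bool (l = k))} \<subseteq> {0..<m}"
      by (force simp: not_le[symmetric])
    then have "card {i \<in> I. \<not> (\<exists>k\<in>I. \<forall>l\<in>I. r i l = of_bool (l = k))} \<le> card {0..<m}"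
      by (intro card_mono) auto
    then show "card {i \<in> I. \<not> (\<exists>k\<in>I. \<forall>l\<in>I. r i l = of_bool (l = k))} \<le> m" by simp
  qed
  obtain f where f: "bij_betw f I I" and adj: "\<And>x y. x \<in> I \<Longrightarrow> y \<in> I \<Longrightarrow> y \<in> N x \<longleftrightarrow> f y \<in> N' (f x)"
    using isomorphic by blast
  define s where "s = inv_into I \<sigma>"
  have s: "bij_betw s V I" unfolding s_def using \<sigma> by (rule bij_betw_inv_into)
  have \<sigma>s: "\<sigma> (s v) = v" if "v \<in> V" for v
    using that \<sigma> by (simp add: s_def bij_betw_inv_into_right)
  have "bij_betw (\<tau> \<circ> (f \<circ> s)) V W" using s f \<tau> by (intro bij_betw_trans)
  moreover have "{u, v} \<in> E \<longleftrightarrow> {(\<tau> \<circ> (f \<circ> s)) u, (\<tau> \<circ> (f \<circ> s)) v} \<in> F" if uv: "u \<in> V" "v \<in> V" for u v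
  proof (cases "u = v")
    case True
    \<comment> \<open>\<open>graph_iso\<close> also quantifies over equal vertices, for which the
      pair collapses to a singleton.\<close>
    have "{x} \<notin> E" "{x} \<notin> F" for x
      using V W by (auto simp: simple_graph_def doubleton_eq_iff)
    then show ?thesis using True by simp
  next
    case False
    have mem: "s u \<in> I" "s v \<in> I" "f (s u) \<in> I" "f (s v) \<in> I"
      using uv bij_betwE[OF s] bij_betwE[OF f] by blast+
    have "s u \<noteq> s v" using False \<sigma>s uv by metis
    then have "f (s u) \<noteq> f (s v)" using f mem by (auto simp: bij_betw_def inj_on_def)
    then show ?thesis using adj[of "s u" "s v"] mem \<open>s u \<noteq> s v\<close> \<sigma>s uv by (auto simp: N_def N'_def)
  qed
  ultimately show ?thesis unfolding graph_iso_def by blast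
qed

text \<open>The core is an induced subgraph, so a subset of it spans the same edges there as in the
  whole graph and sparsity is inherited. Minimum degree 2 comes from peeling.\<close>

lemma bad_event_dense:
  assumes E: "E \<subseteq> all_pairs n" and bad: "bad_event m n E"
  shows "\<exists>X\<subseteq>{0..<n}. card X \<le> 2 * m + 1 \<and> card X < card {e \<in> E. e \<subseteq> X}"
proof (rule ccontr)
  assume "\<not> ?thesis"
  then have sparse: "card {e \<in> E. e \<subseteq> X} \<le> card X" if "X \<subseteq> {0..<n}" "card X \<le> 2 * m + 1" for X
    using that by (meson not_le)
  obtain C where C: "largest_component {0..<n} E C"
    and adm: "admits_noniso_switching m (core2 C (induced_edges E C))
      (induced_edges E (core2 C (induced_edges E C)))"
    using bad unfolding bad_event_def Let_def by blast
  define K where "K = core2 C (induced_edges E C)"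
  have Cn: "C \<subseteq> {0..<n}"
    using C unfolding largest_component_def is_component_def component_def by blast
  have KC: "K \<subseteq> C" unfolding K_def by (rule core2_subset)
  then have Kn: "K \<subseteq> {0..<n}" using Cn by blast
  obtain W F where W: "simple_graph W F" "switching_le m K (induced_edges E K) W F"
    "\<not> graph_iso K (induced_edges E K) W F"
    using adm unfolding admits_noniso_switching_def K_def by blast
  have "graph_iso K (induced_edges E K) W F"
  proof (rule graph_iso_of_switching[OF _ W(1,2)])
    have "e \<in> {{u, v} |u v. u \<in> K \<and> v \<in> K \<and> u \<noteq> v}" if "e \<in> E" "e \<subseteq> K" for e
      using that E unfolding all_pairs_def by blast
    moreover have "finite K" using Kn finite_subset by blast
    ultimately show "simple_graph K (induced_edges E K)"
      unfolding simple_graph_def induced_edges_def by blast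
    show "2 \<le> card {u \<in> K. u \<noteq> v \<and> {u, v} \<in> induced_edges E K}" if v: "v \<in> K" for v
    proof -
      have "finite C" using Cn finite_subset by blast
      then have "2 \<le> card {u \<in> K. u \<noteq> v \<and> {u, v} \<in> induced_edges E C}"
        using core2_min_degree v unfolding K_def by blast
      also have "{u \<in> K. u \<noteq> v \<and> {u, v} \<in> induced_edges E C} =
          {u \<in> K. u \<noteq> v \<and> {u, v} \<in> induced_edges E K}"
        using v KC by (auto simp: induced_edges_def)
      finally show ?thesis .
    qed
    show "card {e \<in> induced_edges E K. e \<subseteq> X} \<le> card X" if "X \<subseteq> K" "card X \<le> 2 * m + 1" for X
    proof -
      have "{e \<in> induced_edges E K. e \<subseteq> X} = {e \<in> E. e \<subseteq> X}"
        using that(1) by (auto simp: induced_edges_def)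
      then show ?thesis using sparse[of X] that Kn by auto
    qed
  qed
  then show False using W(3) by contradiction
qed

section \<open>Dense spots in the random graph\<close>

lemma finite_all_pairs: "finite (all_pairs n)"
proof (rule finite_subset)
  show "all_pairs n \<subseteq> Pow {0..<n}" by (auto simp: all_pairs_def)
qed simp

lemma gnp_subset: "E \<in> set_pmf (gnp n p) \<Longrightarrow> E \<subseteq> all_pairs n"
  unfolding gnp_def set_map_pmf by (elim imageE, simp only:, rule Collect_restrict)

lemma prob_gnp_supset:
  assumes p: "0 \<le> p" "p \<le> 1" and D: "D \<subseteq> all_pairs n"
  shows "measure_pmf.prob (gnp n p) {E. D \<subseteq> E} = p ^ card D"
proof -
  have "(\<lambda>f. {e \<in> all_pairs n. f e}) -` {E. D \<subseteq> E} =
      Pi (all_pairs n) (\<lambda>e. if e \<in> D then {True} else UNIV)"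
    using D by (auto simp: Pi_def)
  then have "measure_pmf.prob (gnp n p) {E. D \<subseteq> E} =
      (\<Prod>e\<in>all_pairs n. measure_pmf.prob (bernoulli_pmf p) (if e \<in> D then {True} else UNIV))"
    unfolding gnp_def using measure_Pi_pmf_Pi[OF finite_all_pairs] by simp
  also have "\<dots> = (\<Prod>e\<in>all_pairs n. if e \<in> D then p else 1)"
    using p by (intro prod.cong refl) (simp add: measure_pmf_single)
  also have "\<dots> = (\<Prod>e\<in>all_pairs n \<inter> D. p)"
    by (rule prod.inter_restrict[OF finite_all_pairs, symmetric])
  also have "all_pairs n \<inter> D = D" using D by blast
  finally show ?thesis by simp
qed

text \<open>Union bound over the vertex set and \<open>k + 1\<close> of the edges inside it. The
  crude factor \<open>2 ^ 2 ^ k\<close> is harmless because \<open>k\<close> will be bounded in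
  terms of \<open>m\<close>.\<close>

lemma prob_dense_le:
  assumes p: "0 \<le> p" "p \<le> 1"
  shows "measure_pmf.prob (gnp n p) {E. \<exists>X\<subseteq>{0..<n}. card X = k \<and> card X < card {e \<in> E. e \<subseteq> X}}
    \<le> 2 ^ 2 ^ k * (real n ^ k * p ^ (k + 1))"
proof -
  define XS where "XS = {X. X \<subseteq> {0..<n} \<and> card X = k}"
  \<comment> \<open>Fixing exactly \<open>k + 1\<close> edges makes each probability
    \<open>p ^ (k + 1)\<close>. There are at most as many choices as sets of subsets of
    \<open>X\<close>.\<close>
  define DS where "DS = (\<lambda>X. {D. D \<subseteq> Pow X \<and> card D = k + 1 \<and> D \<subseteq> all_pairs n})"
  have fXS: "finite XS" unfolding XS_def by simp
  have fX: "finite X" if "X \<in> XS" for X using that finite_subset by (auto simp: XS_def)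
  have DS: "finite (DS X)" "card (DS X) \<le> 2 ^ 2 ^ k" if "X \<in> XS" for X
  proof -
    have "DS X \<subseteq> Pow (Pow X)" unfolding DS_def by blast
    moreover have "finite (Pow (Pow X))" using fX[OF that] by simp
    moreover have "card (Pow (Pow X)) = 2 ^ 2 ^ k" using fX[OF that] that by (simp add: card_Pow XS_def)
    ultimately show "finite (DS X)" "card (DS X) \<le> 2 ^ 2 ^ k" by (metis finite_subset, metis card_mono)
  qed
  define J where "J = (SIGMA X:XS. DS X)"
  have fJ: "finite J" unfolding J_def using fXS DS by blast
  have sub: "{E. \<exists>X\<subseteq>{0..<n}. card X = k \<and> card X < card {e \<in> E. e \<subseteq> X}} \<inter> set_pmf (gnp n p)
      \<subseteq> (\<Union>z\<in>J. {E. snd z \<subseteq> E})"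
  proof
    fix E assume "E \<in> {E. \<exists>X\<subseteq>{0..<n}. card X = k \<and> card X < card {e \<in> E. e \<subseteq> X}} \<inter> set_pmf (gnp n p)"
    then obtain X where X: "X \<in> XS" "k + 1 \<le> card {e \<in> E. e \<subseteq> X}" and "E \<subseteq> all_pairs n"
      using gnp_subset unfolding XS_def by auto
    obtain D where D: "D \<subseteq> {e \<in> E. e \<subseteq> X}" "card D = k + 1"
      by (rule obtain_subset_with_card_n[OF X(2)])
    then have "D \<subseteq> Pow X" "D \<subseteq> E" by blast+
    then have "(X, D) \<in> J" using X(1) D(2) \<open>E \<subseteq> all_pairs n\<close> unfolding J_def DS_def by blast
    then show "E \<in> (\<Union>z\<in>J. {E. snd z \<subseteq> E})" using \<open>D \<subseteq> E\<close> by (intro UN_I[of "(X, D)"]) auto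
  qed
  have "measure_pmf.prob (gnp n p) {E. \<exists>X\<subseteq>{0..<n}. card X = k \<and> card X < card {e \<in> E. e \<subseteq> X}} =
      measure_pmf.prob (gnp n p)
        ({E. \<exists>X\<subseteq>{0..<n}. card X = k \<and> card X < card {e \<in> E. e \<subseteq> X}} \<inter> set_pmf (gnp n p))"
    by (rule measure_Int_set_pmf[symmetric])
  also have "\<dots> \<le> measure_pmf.prob (gnp n p) (\<Union>z\<in>J. {E. snd z \<subseteq> E})"
    by (rule measure_pmf.finite_measure_mono[OF sub]) simp
  also have "\<dots> \<le> (\<Sum>z\<in>J. measure_pmf.prob (gnp n p) {E. snd z \<subseteq> E})"
    by (rule measure_pmf.finite_measure_subadditive_finite[OF fJ]) simp
  also have "\<dots> = (\<Sum>z\<in>J. p ^ (k + 1))"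
    using prob_gnp_supset[OF p] by (intro sum.cong refl) (auto simp: J_def DS_def)
  also have "\<dots> = real (card J) * p ^ (k + 1)" by simp
  also have "\<dots> \<le> (2 ^ 2 ^ k * real n ^ k) * p ^ (k + 1)"
  proof (rule mult_right_mono)
    have "card J = (\<Sum>X\<in>XS. card (DS X))" unfolding J_def using fXS DS(1) by (intro card_SigmaI) auto
    also have "\<dots> \<le> (\<Sum>X\<in>XS. 2 ^ 2 ^ k)" using DS(2) by (rule sum_mono)
    also have "\<dots> = (n choose k) * 2 ^ 2 ^ k" using n_subsets[of "{0..<n}" k] by (simp add: XS_def)
    also have "\<dots> \<le> n ^ k * 2 ^ 2 ^ k"
      using binomial_le_pow[of k n] by (cases "k \<le> n") (auto simp: binomial_eq_0)
    finally have "real (card J) \<le> real (n ^ k * 2 ^ 2 ^ k)" by (rule of_nat_mono)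
    then show "real (card J) \<le> 2 ^ 2 ^ k * real n ^ k" by (simp add: mult.commute)
  qed (use p in simp)
  finally show ?thesis by (simp add: mult.assoc)
qed

text \<open>Since \<open>l\<close> is at least 1, the powers \<open>l ^ (k + 1)\<close> are
  dominated by the one for k = 2m + 1; \<open>l \<le> real n\<close> makes the edge probability at
  most 1.\<close>

lemma prob_bad_event_le:
  fixes l :: real
  assumes l: "1 \<le> l" "l \<le> real n"
  shows "measure_pmf.prob (gnp n (l / real n)) {E. bad_event m n E}
    \<le> (\<Sum>k\<le>2 * m + 1. 2 ^ 2 ^ k) * (l ^ (2 * m + 2) / real n)"
proof -
  define p where "p = l / real n"
  have n: "0 < real n" using l by linarith
  have p: "0 \<le> p" "p \<le> 1" using l n by (simp_all add: p_def)
  let ?A = "\<lambda>k. {E. \<exists>X\<subseteq>{0..<n}. card X = k \<and> card X < card {e \<in> E. e \<subseteq> X}}"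
  have "{E. bad_event m n E} \<inter> set_pmf (gnp n p) \<subseteq> (\<Union>k\<in>{..2 * m + 1}. ?A k)"
  proof
    fix E assume "E \<in> {E. bad_event m n E} \<inter> set_pmf (gnp n p)"
    then have "bad_event m n E" "E \<subseteq> all_pairs n" using gnp_subset by blast+
    from bad_event_dense[OF this(2,1)] show "E \<in> (\<Union>k\<in>{..2 * m + 1}. ?A k)" by blast
  qed
  then have "measure_pmf.prob (gnp n p) ({E. bad_event m n E} \<inter> set_pmf (gnp n p))
      \<le> measure_pmf.prob (gnp n p) (\<Union>k\<in>{..2 * m + 1}. ?A k)"
    by (rule measure_pmf.finite_measure_mono) simp
  then have "measure_pmf.prob (gnp n p) {E. bad_event m n E}
      \<le> measure_pmf.prob (gnp n p) (\<Union>k\<in>{..2 * m + 1}. ?A k)"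
    by (simp add: measure_Int_set_pmf)
  also have "\<dots> \<le> (\<Sum>k\<le>2 * m + 1. measure_pmf.prob (gnp n p) (?A k))"
    by (rule measure_pmf.finite_measure_subadditive_finite) auto
  also have "\<dots> \<le> (\<Sum>k\<le>2 * m + 1. 2 ^ 2 ^ k * (l ^ (2 * m + 2) / real n))"
  proof (rule sum_mono)
    fix k assume k: "k \<in> {..2 * m + 1}"
    have "real n ^ k * p ^ (k + 1) = l ^ (k + 1) / real n"
      using n by (simp add: p_def power_divide)
    also have "\<dots> \<le> l ^ (2 * m + 2) / real n"
      using l k by (intro divide_right_mono power_increasing) auto
    finally show "measure_pmf.prob (gnp n p) (?A k) \<le> 2 ^ 2 ^ k * (l ^ (2 * m + 2) / real n)"
      using prob_dense_le[OF p, of n k] by (meson order.trans mult_left_mono zero_le_numeral zero_le_power)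
  qed
  finally show ?thesis by (simp only: p_def sum_distrib_right)
qed

theorem theorem1p7:
  fixes lam :: "nat \<Rightarrow> real" and m :: nat
  assumes "m \<ge> 1"
    and "\<forall>n. lam n > 1"
    and "\<exists>\<epsilon>>0. \<forall>n. lam n \<ge> 1 + \<epsilon>"
    and "lam \<in> o(\<lambda>n. real n powr (1 / (2 * real m + 2)))"
  shows "(\<lambda>n. measure_pmf.prob (gnp n (lam n / real n)) {E. bad_event m n E})
           \<longlonglongrightarrow> 0"
proof -
  define c where "c = (\<Sum>k\<le>2 * m + 1. 2 ^ 2 ^ k :: real)"
  have lam: "1 \<le> lam n" for n using assms(2) less_imp_le by blast
  \<comment> \<open>Raising the growth condition to the power 2m + 2 turns the root of
    \<open>n\<close> into \<open>n\<close> itself.\<close>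
  have "(\<lambda>n. (lam n / real n powr (1 / (2 * real m + 2))) ^ (2 * m + 2)) \<longlonglongrightarrow> 0 ^ (2 * m + 2)"
    by (intro tendsto_power smalloD_tendsto assms(4))
  moreover have "(lam n / real n powr (1 / (2 * real m + 2))) ^ (2 * m + 2) = lam n ^ (2 * m + 2) / real n"
    if "n > 0" for n
  proof -
    have "(real n powr (1 / (2 * real m + 2))) ^ (2 * m + 2) =
        real n powr (1 / (2 * real m + 2) * (2 * real m + 2))"
      using that powr_realpow[of "real n powr (1 / (2 * real m + 2))" "2 * m + 2"]
      by (simp only: powr_powr of_nat_add of_nat_mult of_nat_numeral) simp
    also have "1 / (2 * real m + 2) * (2 * real m + 2) = 1" by (simp add: add_nonneg_eq_0_iff)
    finally have "(real n powr (1 / (2 * real m + 2))) ^ (2 * m + 2) = real n" using that by simp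
    then show ?thesis by (simp only: power_divide)
  qed
  then have "\<forall>\<^sub>F n in sequentially. (lam n / real n powr (1 / (2 * real m + 2))) ^ (2 * m + 2) =
      lam n ^ (2 * m + 2) / real n"
    using eventually_gt_at_top[of 0] by (rule eventually_mono[rotated])
  ultimately have lim: "(\<lambda>n. lam n ^ (2 * m + 2) / real n) \<longlonglongrightarrow> 0"
    by (simp add: tendsto_cong)
  then have "\<forall>\<^sub>F n in sequentially. lam n ^ (2 * m + 2) / real n < 1"
    by (rule order_tendstoD) simp
  then have "\<forall>\<^sub>F n in sequentially. measure_pmf.prob (gnp n (lam n / real n)) {E. bad_event m n E}
      \<le> c * (lam n ^ (2 * m + 2) / real n)"
    using eventually_gt_at_top[of 0]
  proof eventually_elim
    case (elim n)
    \<comment> \<open>The limit just obtained also supplies the edge probability bound: eventually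
      \<open>lam n ^ (2 * m + 2)\<close> is below \<open>n\<close>, hence so is
      \<open>lam n\<close>.\<close>
    have "lam n \<le> lam n ^ (2 * m + 2)" using lam[of n] by (intro self_le_power) auto
    also have "\<dots> \<le> real n" using elim by (simp add: divide_less_eq)
    finally show ?case unfolding c_def using prob_bad_event_le lam by blast
  qed
  moreover have "(\<lambda>n. c * (lam n ^ (2 * m + 2) / real n)) \<longlonglongrightarrow> 0"
    using tendsto_mult_right_zero[OF lim] .
  ultimately show ?thesis
    by (rule tendsto_sandwich[OF always_eventually[OF allI[OF measure_nonneg]] _ tendsto_const])
qed

end
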